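(* Let $(a_1,a_2,\dots)$ be drawn at random from the set $\Omega$ of infinite sequences with entries in $\{-1,1\}$, equipped with the probability measure determined by \[ \Pr\big[(a_1,a_2,\dots)\in\Omega: a_1=c_1,\dots,a_n=c_n\big]=2^{-n}\quad\text{for all } n\ge 1 \text{ and } (c_1,\dots,c_n)\in\{-1,1\}^n, \] and write $A_n=(a_1,a_2,\dots,a_n)$. Let $r\ge 2$ be a fixed integer. Then, as $n\to\infty$, \[ \frac{C_r(A_n)}{\sqrt{2n\log\binom{n}{r-1}}}\to 1\quad\text{almost surely}. \]
   Context: For $A_n=(a_1,\dots,a_n)\in\{-1,1\}^n$ and $2\le r\le n$, the $r$-th order correlation measure of $A_n$ is \[ C_r(A_n)=\max_{0\le u_1<u_2<\cdots<u_r<n}\;\max_{1\le m\le n-u_r}\left|\sum_{j=1}^m a_{j+u_1}a_{j+u_2}\cdots a_{j+u_r}\right|, \] where $u_1,\dots,u_r$ and $m$ are integers. $\log$ is the natural logarithm. *)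

theory Defs
  imports "HOL-Probability.Probability"
begin

text \<open>
  A tuple \<open>(a\<^sub>1, \<dots>, a\<^sub>n)\<close> is a function on \<open>{1..n}\<close>, and an infinite sequence
  \<open>(a\<^sub>1, a\<^sub>2, \<dots>)\<close> is a function on \<open>{1..}\<close>.
\<close>

definition initial_segment :: "nat \<Rightarrow> (nat \<Rightarrow> int) \<Rightarrow> (nat \<Rightarrow> int)" where
  "initial_segment n a = restrict a {1..n}"

definition shift_tuples :: "nat \<Rightarrow> nat \<Rightarrow> (nat \<Rightarrow> nat) set" where
  "shift_tuples r n = {u \<in> {1..r} \<rightarrow>\<^sub>E {0..<n}. strict_mono_on {1..r} u}"

text \<open>
  Meaningful for \<open>1 \<le> r \<le> n\<close> only: for \<open>r > n\<close> there are no shifts and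
  the outer maximum is over the empty set.
\<close>

definition correlation_measure :: "nat \<Rightarrow> nat \<Rightarrow> (nat \<Rightarrow> int) \<Rightarrow> int" where
  "correlation_measure r n a =
     (MAX u \<in> shift_tuples r n. MAX m \<in> {1..n - u r}.
        \<bar>\<Sum>j = 1..m. \<Prod>i = 1..r. a (j + u i)\<bar>)"

text \<open>
  The underlying set is the set \<open>\<Omega>\<close> of sequences with entries in \<open>{-1, 1}\<close>, and the
  measurable sets form the product sigma-algebra, generated by the cylinders. The
  values of this measure (built from counting measures) are not used.
\<close>

definition sign_sequences :: "(nat \<Rightarrow> int) measure" where
  "sign_sequences = (\<Pi>\<^sub>M i\<in>{1..}. count_space {-1, 1})"

lemma space_sign_sequences: "space sign_sequences = {1..} \<rightarrow>\<^sub>E {-1, 1}"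
  by (simp add: sign_sequences_def space_PiM)

lemma finite_shift_tuples: "finite (shift_tuples r n)"
  by (auto simp: shift_tuples_def intro!: finite_subset[OF _ finite_PiE[of "{1..r}" "\<lambda>_. {0..<n}"]])

lemma shift_tuples_nonempty:
  assumes "r \<le> n"
  shows "shift_tuples r n \<noteq> {}"
proof -
  have "restrict (\<lambda>i. i - 1) {1..r} \<in> shift_tuples r n"
    using assms by (auto simp: shift_tuples_def intro!: strict_mono_onI)
  then show ?thesis by blast
qed

text \<open>A probability measure with the prescribed cylinder probabilities exists.\<close>

lemma ex_sign_sequence_measure:
  "\<exists>M. prob_space M \<and> sets M = sets sign_sequences \<and>
     (\<forall>n\<ge>1. \<forall>c \<in> {1..n} \<rightarrow>\<^sub>E {-1, 1}. \<P>(a in M. \<forall>i\<in>{1..n}. a i = c i) = 1 / 2 ^ n)"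
proof -
  let ?B = "uniform_count_measure {-1, 1 :: int}"
  interpret B: prob_space ?B by (rule prob_space_uniform_count_measure) auto
  interpret P: product_prob_space "\<lambda>_. ?B" "{1::nat..}" by unfold_locales
  let ?M = "\<Pi>\<^sub>M i\<in>{1::nat..}. ?B"
  have S: "sets ?M = sets sign_sequences"
    unfolding sign_sequences_def
    by (rule sets_PiM_cong) (auto simp: sets_uniform_count_measure)
  have "\<P>(a in ?M. \<forall>i\<in>{1..n}. a i = c i) = 1 / 2 ^ n" if c: "c \<in> {1..n} \<rightarrow>\<^sub>E {-1, 1}" for n c
  proof -
    have "{a \<in> space ?M. \<forall>i\<in>{1..n}. a i = c i} = prod_emb {1..} (\<lambda>_. ?B) {1..n} (\<Pi>\<^sub>E i\<in>{1..n}. {c i})"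
      by (auto simp: prod_emb_def space_PiM PiE_iff restrict_def extensional_def)
    then have "\<P>(a in ?M. \<forall>i\<in>{1..n}. a i = c i) = (\<Prod>i\<in>{1..n}. measure ?B {c i})"
      using c by (subst P.measure_PiM_emb[symmetric]) (auto simp: sets_uniform_count_measure PiE_iff)
    also have "\<dots> = (\<Prod>i\<in>{1..n}. 1 / 2)"
      using c by (intro prod.cong refl) (auto simp: measure_uniform_count_measure PiE_iff)
    finally show ?thesis by (simp add: power_one_over)
  qed
  then show ?thesis using S P.prob_space_axioms by blast
qed

end

theory Submission
  imports Defs "HOL-Real_Asymp.Real_Asymp"
begin

text \<open>
  Write \<open>p = r - 1\<close> and \<open>L n = sqrt (2 n p ln n)\<close>. Since \<open>ln (n choose p)\<close> is asymptotic to
  \<open>p ln n\<close>, the claim is that \<open>C\<^sub>r(A\<^sub>n) / L n\<close> tends to 1. The measure \<open>C\<^sub>r\<close> is the largest modulus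
  of a sum \<open>\<Sum>\<^bsub>s < j \<le> e\<^esub> \<Prod>\<^bsub>i \<in> T\<^esub> a (j + i)\<close> over \<open>r\<close>-element sets \<open>T\<close> (\<open>pattern_sum\<close>). For one
  fixed \<open>T\<close> the summands are independent fair signs, because each of them contains a last factor that
  no earlier summand contains. So a pattern sum is a simple random walk, and everything about it, and
  about pairs of such walks, follows from one exponential martingale (\<open>exponential_martingale\<close>).

  Upper bound (\<open>correlation_upper_tail\<close>). Translate each pattern so that it contains 0. Then only
  about \<open>n\<^sup>p\<close> patterns remain instead of \<open>n\<^sup>r\<close>, but all segments of each walk have to be controlled and
  not just its initial ones. The ends of a segment are rounded to a grid with boundedly many points.
  For grid segments, the union bound over patterns against the Gaussian tail \<open>n powr (- p (1 + \<epsilon>)\<^sup>2)\<close>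
  succeeds. The rounding errors are walks of length at most \<open>\<delta> n\<close>, and for small \<open>\<delta>\<close> they exceed
  \<open>\<epsilon> L n / 2\<close> so rarely that there is room for a union bound over all short segments.

  Lower bound (\<open>correlation_lower_tail\<close>). Consider the patterns \<open>W \<union> {D}\<close>, where \<open>D\<close> is about
  \<open>\<alpha> n\<close> and \<open>W\<close> runs through the \<open>p\<close>-element subsets of \<open>{..<D}\<close>; up to a constant factor there are
  \<open>n\<^sup>p\<close> of them. At any time, the increments of the walks for \<open>V\<close> and \<open>W\<close> share their last factor, and
  the product of the increments is an increment of the walk for the symmetric difference of \<open>V\<close> and
  \<open>W\<close>. The latter walk is at most \<open>\<eta> N\<close> after \<open>N\<close> steps outside an event of exponentially small
  probability, so the two walks are jointly large with at most about the product of the single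
  probabilities, up to a factor \<open>n powr (2 p \<eta>)\<close>. The second moment method then shows that \<open>C\<^sub>r\<close> comes
  close to \<open>L n\<close> with probability at least a small negative power of \<open>n\<close>. This weak bound is enough:
  changing one sign changes \<open>C\<^sub>r\<close> by at most \<open>2 r\<close>, so by the bounded differences inequality \<open>C\<^sub>r\<close> is
  within \<open>\<alpha> L n\<close> of its mean except with probability \<open>n powr (- c)\<close>. Hence the mean itself is close to
  \<open>L n\<close>, and \<open>C\<^sub>r\<close> falls below it by much only with probability \<open>n powr (- c)\<close>.

  Both tails decay only polynomially, with a possibly small exponent. The Borel-Cantelli lemma is
  therefore applied along \<open>n = k\<^sup>q\<close> for a large \<open>q\<close>. As \<open>C\<^sub>r(A\<^sub>n)\<close> and \<open>L n\<close> are monotone in \<open>n\<close> and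
  \<open>L ((k + 1)\<^sup>q) / L (k\<^sup>q)\<close> tends to 1, the estimates extend to all \<open>n\<close>.
\<close>


section \<open>Averages over finite sign vectors\<close>

definition sign_cube :: "nat \<Rightarrow> (nat \<Rightarrow> int) set" where
  "sign_cube n = {1..n} \<rightarrow>\<^sub>E {-1, 1}"

text \<open>
  Everything about a fixed \<open>n\<close> is an average over the \<open>2\<^sup>n\<close> equally likely sign vectors, so the
  probabilistic part is carried out with finite sums.
\<close>

definition sign_mean :: "nat \<Rightarrow> ((nat \<Rightarrow> int) \<Rightarrow> real) \<Rightarrow> real" where
  "sign_mean n f = (\<Sum>a\<in>sign_cube n. f a) / 2 ^ n"

definition sign_prob :: "nat \<Rightarrow> ((nat \<Rightarrow> int) \<Rightarrow> bool) \<Rightarrow> real" where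
  "sign_prob n Q = sign_mean n (\<lambda>a. of_bool (Q a))"

lemma finite_sign_cube: "finite (sign_cube n)"
  by (simp add: sign_cube_def finite_PiE)

lemma sign_cube_range: "a \<in> sign_cube n \<Longrightarrow> 1 \<le> i \<Longrightarrow> i \<le> n \<Longrightarrow> a i = 1 \<or> a i = -1"
  by (force simp: sign_cube_def PiE_iff)

lemma sign_cube_upd: "a \<in> sign_cube n \<Longrightarrow> x = 1 \<or> x = -1 \<Longrightarrow> a(Suc n := x) \<in> sign_cube (Suc n)"
  by (auto simp: sign_cube_def PiE_iff extensional_def)

lemma sign_mean_0: "sign_mean 0 f = f (\<lambda>_. undefined)"
  by (simp add: sign_mean_def sign_cube_def)

text \<open>
  Conditioning on all signs but the last; this is the step of every induction on the number of signs.
\<close>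

lemma sign_mean_Suc:
  "sign_mean (Suc n) f = sign_mean n (\<lambda>a. (f (a(Suc n := 1)) + f (a(Suc n := - 1))) / 2)"
proof -
  have ins: "{1..Suc n} = insert (Suc n) {1..n}" by auto
  have inj: "inj_on (\<lambda>(y, g). g(Suc n := y)) ({- 1, 1} \<times> sign_cube n)"
    unfolding inj_on_def
  proof clarify
    fix a b :: int and g h :: "nat \<Rightarrow> int"
    assume gh: "g \<in> sign_cube n" "h \<in> sign_cube n" and eq: "g(Suc n := a) = h(Suc n := b)"
    have "g (Suc n) = h (Suc n)" using gh by (simp add: sign_cube_def PiE_def extensional_def)
    moreover have "g x = h x" if "x \<noteq> Suc n" for x using fun_cong[OF eq, of x] that by simp
    ultimately show "a = b \<and> g = h" using fun_cong[OF eq, of "Suc n"] by (metis ext fun_upd_same)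
  qed
  have "(\<Sum>a\<in>sign_cube (Suc n). f a) = (\<Sum>(y, g)\<in>{- 1, 1} \<times> sign_cube n. f (g(Suc n := y)))"
    unfolding sign_cube_def ins PiE_insert_eq
    by (subst sum.reindex) (use inj in \<open>auto simp: sign_cube_def split_beta intro!: sum.cong\<close>)
  also have "\<dots> = (\<Sum>y\<in>{-1, 1}. \<Sum>g\<in>sign_cube n. f (g(Suc n := y)))"
    by (rule sum.cartesian_product[symmetric])
  also have "\<dots> = (\<Sum>g\<in>sign_cube n. f (g(Suc n := 1)) + f (g(Suc n := - 1)))"
    by (simp add: sum.distrib)
  finally show ?thesis by (simp add: sign_mean_def sum_divide_distrib)
qed

lemma sign_mean_cong: "(\<And>a. a \<in> sign_cube n \<Longrightarrow> f a = g a) \<Longrightarrow> sign_mean n f = sign_mean n g"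
  unfolding sign_mean_def by (metis sum.cong)

lemma sign_mean_mono: "(\<And>a. a \<in> sign_cube n \<Longrightarrow> f a \<le> g a) \<Longrightarrow> sign_mean n f \<le> sign_mean n g"
  unfolding sign_mean_def by (simp add: divide_right_mono sum_mono)

lemma sign_mean_cmult: "sign_mean n (\<lambda>a. c * f a) = c * sign_mean n f"
  by (simp add: sign_mean_def sum_distrib_left)

lemma sign_mean_add: "sign_mean n (\<lambda>a. f a + g a) = sign_mean n f + sign_mean n g"
  by (simp add: sign_mean_def sum.distrib add_divide_distrib)

lemma sign_mean_uminus: "sign_mean n (\<lambda>a. - f a) = - sign_mean n f"
  by (simp add: sign_mean_def sum_negf)

lemma sign_mean_sum: "sign_mean n (\<lambda>a. \<Sum>x\<in>X. f x a) = (\<Sum>x\<in>X. sign_mean n (f x))"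
  unfolding sign_mean_def by (subst sum.swap) (simp add: sum_divide_distrib)

lemma sign_mean_Cauchy_Schwarz:
  "(sign_mean n (\<lambda>a. f a * g a))\<^sup>2 \<le> sign_mean n (\<lambda>a. (f a)\<^sup>2) * sign_mean n (\<lambda>a. (g a)\<^sup>2)"
  using Cauchy_Schwarz_ineq_sum[of f g "sign_cube n"]
  by (simp add: sign_mean_def power_divide divide_right_mono power2_eq_square)

lemma sign_prob_le_mean:
  assumes "\<And>a. a \<in> sign_cube n \<Longrightarrow> 0 \<le> f a" "\<And>a. a \<in> sign_cube n \<Longrightarrow> Q a \<Longrightarrow> 1 \<le> f a"
  shows "sign_prob n Q \<le> sign_mean n f"
  unfolding sign_prob_def by (rule sign_mean_mono) (use assms in auto)

lemma sign_prob_mono: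
  assumes "\<And>a. a \<in> sign_cube n \<Longrightarrow> Q a \<Longrightarrow> R a"
  shows "sign_prob n Q \<le> sign_prob n R"
  unfolding sign_prob_def by (rule sign_mean_mono) (use assms in auto)

lemma sign_prob_disj: "sign_prob n (\<lambda>a. Q a \<or> R a) \<le> sign_prob n Q + sign_prob n R"
  unfolding sign_prob_def sign_mean_add[symmetric] by (rule sign_mean_mono) auto

lemma sign_prob_Bex:
  fixes B :: real
  assumes "finite X" "\<And>x. x \<in> X \<Longrightarrow> sign_prob n (Q x) \<le> B"
  shows "sign_prob n (\<lambda>a. \<exists>x\<in>X. Q x a) \<le> card X * B"
proof -
  have "sign_prob n (\<lambda>a. \<exists>x\<in>X. Q x a) \<le> sign_mean n (\<lambda>a. \<Sum>x\<in>X. of_bool (Q x a))"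
  proof (rule sign_prob_le_mean)
    fix a assume "\<exists>x\<in>X. Q x a"
    then obtain x where "x \<in> X" "Q x a" by blast
    then show "1 \<le> (\<Sum>x\<in>X. of_bool (Q x a) :: real)"
      using member_le_sum[of x X "\<lambda>x. of_bool (Q x a) :: real"] assms(1) by simp
  qed (simp add: sum_nonneg)
  also have "\<dots> = (\<Sum>x\<in>X. sign_prob n (Q x))" by (simp add: sign_mean_sum sign_prob_def)
  also have "\<dots> \<le> card X * B" using sum_bounded_above[of X "\<lambda>x. sign_prob n (Q x)" B] assms(2) by simp
  finally show ?thesis .
qed

lemma sign_prob_nonneg: "0 \<le> sign_prob n Q"
  by (simp add: sign_prob_def sign_mean_def sum_nonneg)

lemma tanh_le_self: assumes "0 \<le> (x::real)" shows "tanh x \<le> x"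
proof -
  have "0 - tanh 0 \<le> x - tanh x"
  proof (rule DERIV_nonneg_imp_nondecreasing[OF assms])
    fix y :: real
    have "((\<lambda>x. x - tanh x) has_real_derivative (1 - (1 - tanh y ^ 2))) (at y)"
      by (auto intro!: derivative_eq_intros simp: field_simps)
    then show "\<exists>z. ((\<lambda>x. x - tanh x) has_real_derivative z) (at y) \<and> 0 \<le> z" by fastforce
  qed
  then show ?thesis by simp
qed

text \<open>
  The moment generating function of a fair sign is dominated by that of a standard Gaussian. The
  difference of the logarithms has derivative \<open>x - tanh x\<close>, which is nonnegative for \<open>x \<ge> 0\<close>.
\<close>

lemma cosh_le_exp_half_square: "cosh (x::real) \<le> exp (x\<^sup>2 / 2)"
proof -
  have pos: "cosh x \<le> exp (x\<^sup>2 / 2)" if "0 \<le> x" for x :: real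
  proof -
    have "0\<^sup>2 / 2 - ln (cosh 0) \<le> x\<^sup>2 / 2 - ln (cosh x)"
    proof (rule DERIV_nonneg_imp_nondecreasing[OF that])
      fix y :: real assume "0 \<le> y"
      have "((\<lambda>x. x\<^sup>2 / 2 - ln (cosh x)) has_real_derivative (y - tanh y)) (at y)"
        by (auto intro!: derivative_eq_intros simp: tanh_def)
      then show "\<exists>z. ((\<lambda>x. x\<^sup>2 / 2 - ln (cosh x)) has_real_derivative z) (at y) \<and> 0 \<le> z"
        using tanh_le_self[OF \<open>0 \<le> y\<close>] by fastforce
    qed
    then have "ln (cosh x) \<le> x\<^sup>2 / 2" by simp
    then show ?thesis by (metis cosh_real_pos exp_le_cancel_iff exp_ln)
  qed
  show ?thesis using pos[of "\<bar>x\<bar>"] by (cases "0 \<le> x") (auto simp: abs_if)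
qed

text \<open>
  The \<open>k\<close>-th function may look at the signs before time \<open>k\<close> only, as for the integrand of a
  martingale transform.
\<close>

definition predictable :: "(nat \<Rightarrow> (nat \<Rightarrow> int) \<Rightarrow> 'b) \<Rightarrow> bool" where
  "predictable H \<longleftrightarrow> (\<forall>k a b. (\<forall>i<k. a i = b i) \<longrightarrow> H k a = H k b)"

lemma predictable_upd: "predictable H \<Longrightarrow> k \<le> m \<Longrightarrow> H k (a(m := x)) = H k a"
  unfolding predictable_def by (metis fun_upd_other not_less)

text \<open>
  Given the signs before time \<open>k\<close>, the weight \<open>H k a\<close> is a constant \<open>h\<close>, and averaging over the
  fresh sign turns \<open>exp (\<plusminus> h)\<close> into \<open>cosh h\<close>.
\<close>

lemma exponential_martingale:
  fixes H :: "nat \<Rightarrow> (nat \<Rightarrow> int) \<Rightarrow> real"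
  assumes "predictable H"
  shows "sign_mean n (\<lambda>a. \<Prod>k\<in>{1..n}. exp (of_int (a k) * H k a) / cosh (H k a)) = 1"
proof (induction n)
  case (Suc n)
  let ?P = "\<lambda>a. \<Prod>k\<in>{1..n}. exp (of_int (a k) * H k a) / cosh (H k a)"
  have old: "?P (a(Suc n := x)) = ?P a" for a x
    by (rule prod.cong) (auto simp: predictable_upd[OF assms])
  have split: "(\<Prod>k\<in>{1..Suc n}. exp (of_int ((a(Suc n := x)) k) * H k (a(Suc n := x))) / cosh (H k (a(Suc n := x))))
        = ?P a * (exp (of_int x * H (Suc n) a) / cosh (H (Suc n) a))" for a x
    using old[of a x] by (simp add: predictable_upd[OF assms])
  have "(p * (exp h / cosh h) + p * (exp (- h) / cosh h)) / 2 = p" for p h :: real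
  proof -
    have "(p * (exp h / cosh h) + p * (exp (- h) / cosh h)) / 2 = p * ((exp h + exp (- h)) / 2) / cosh h"
      by (simp add: field_simps)
    also have "(exp h + exp (- h)) / 2 = cosh h" by (simp add: cosh_def)
    finally show ?thesis using cosh_real_pos[of h] by simp
  qed
  then show ?case
    unfolding sign_mean_Suc split using Suc by simp
qed (simp add: sign_mean_0)

text \<open>
  McDiarmid's inequality for signs. Fixing the last sign gives two functions whose values differ by at
  most \<open>c\<close>. Their exponentials average to \<open>exp g * cosh d\<close> with \<open>g\<close> the mean of the two and
  \<open>\<bar>d\<bar> \<le> c / 2\<close>, and \<open>g\<close> again has bounded differences.
\<close>

lemma exp_mean_bounded_differences:
  assumes "\<And>a i. a \<in> sign_cube n \<Longrightarrow> i \<in> {1..n} \<Longrightarrow> \<bar>f (a(i := 1)) - f (a(i := - 1))\<bar> \<le> c"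
  shows "sign_mean n (\<lambda>a. exp (f a)) \<le> exp (sign_mean n f + n * c\<^sup>2 / 8)"
  using assms
proof (induction n arbitrary: f)
  case (Suc n)
  define g where "g a = (f (a(Suc n := 1)) + f (a(Suc n := - 1))) / 2" for a
  have comm: "(a(i := x))(Suc n := y) = (a(Suc n := y))(i := x)" if "i \<in> {1..n}" for a :: "nat \<Rightarrow> int" and i x y
    using that by (auto intro: fun_upd_twist)
  have "\<bar>g (a(i := 1)) - g (a(i := - 1))\<bar> \<le> c" if "a \<in> sign_cube n" "i \<in> {1..n}" for a i
  proof -
    have "\<bar>f (a(Suc n := y, i := 1)) - f (a(Suc n := y, i := - 1))\<bar> \<le> c" if "y = 1 \<or> y = -1" for y
      using Suc.prems[of "a(Suc n := y)" i] sign_cube_upd[OF \<open>a \<in> sign_cube n\<close> that] \<open>i \<in> {1..n}\<close>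
      by (simp del: fun_upd_apply)
    from this[of 1] this[of "-1"] show ?thesis
      unfolding g_def comm[OF that(2)] abs_le_iff by (simp del: fun_upd_apply) argo
  qed
  note IH = Suc.IH[of g, OF this]
  have step: "(exp (f (a(Suc n := 1))) + exp (f (a(Suc n := - 1)))) / 2 \<le> exp (c\<^sup>2 / 8) * exp (g a)"
    if "a \<in> sign_cube n" for a
  proof -
    define d where "d = (f (a(Suc n := 1)) - f (a(Suc n := - 1))) / 2"
    have "\<bar>f (a(Suc n := 1)) - f (a(Suc n := - 1))\<bar> \<le> c"
      using Suc.prems[of "a(Suc n := 1)" "Suc n"] sign_cube_upd[OF that, of 1]
      by (simp del: fun_upd_apply)
    then have "\<bar>d\<bar> \<le> c / 2" by (simp add: d_def)
    then have "d\<^sup>2 \<le> (c / 2)\<^sup>2" by (metis abs_ge_zero power2_abs power_mono)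
    then have "d\<^sup>2 / 2 \<le> c\<^sup>2 / 8" by (simp add: power_divide)
    then have ch: "cosh d \<le> exp (c\<^sup>2 / 8)"
      using cosh_le_exp_half_square[of d] by (meson exp_le_cancel_iff order_trans)
    have "f (a(Suc n := 1)) = g a + d" "f (a(Suc n := - 1)) = g a - d"
      by (auto simp: g_def d_def field_simps)
    then have "(exp (f (a(Suc n := 1))) + exp (f (a(Suc n := - 1)))) / 2 = (exp (g a + d) + exp (g a - d)) / 2"
      by (simp only:)
    also have "\<dots> = exp (g a) * cosh d"
      by (simp add: cosh_def exp_add exp_diff exp_minus field_simps)
    finally have "(exp (f (a(Suc n := 1))) + exp (f (a(Suc n := - 1)))) / 2 = exp (g a) * cosh d" .
    then show ?thesis using ch by simp
  qed
  have "sign_mean (Suc n) (\<lambda>a. exp (f a)) \<le> sign_mean n (\<lambda>a. exp (c\<^sup>2 / 8) * exp (g a))"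
    unfolding sign_mean_Suc by (rule sign_mean_mono) (rule step)
  also have "\<dots> \<le> exp (c\<^sup>2 / 8) * exp (sign_mean n g + n * c\<^sup>2 / 8)"
    unfolding sign_mean_cmult using IH by simp
  also have "sign_mean n g = sign_mean (Suc n) f" by (simp add: sign_mean_Suc g_def[abs_def])
  finally show ?case by (simp add: field_simps flip: exp_add)
qed (simp add: sign_mean_0)

lemma bounded_differences_upper_tail:
  assumes bd: "\<And>a i. a \<in> sign_cube n \<Longrightarrow> i \<in> {1..n} \<Longrightarrow> \<bar>f (a(i := 1)) - f (a(i := - 1))\<bar> \<le> c"
    and "0 < c" "0 < n" "0 \<le> \<theta>"
  shows "sign_prob n (\<lambda>a. sign_mean n f + \<theta> \<le> f a) \<le> exp (- 2 * \<theta>\<^sup>2 / (n * c\<^sup>2))"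
proof -
  \<comment> \<open>This \<open>s\<close> minimizes the exponent \<open>- s * \<theta> + n * (s * c)\<^sup>2 / 8\<close>.\<close>
  define s where "s = 4 * \<theta> / (n * c\<^sup>2)"
  have s0: "0 \<le> s" using assms by (simp add: s_def)
  define K where "K = - s * (sign_mean n f + \<theta>)"
  have "sign_prob n (\<lambda>a. sign_mean n f + \<theta> \<le> f a) \<le> sign_mean n (\<lambda>a. exp K * exp (s * f a))"
  proof (rule sign_prob_le_mean)
    fix a assume "sign_mean n f + \<theta> \<le> f a"
    then have "0 \<le> s * (f a - (sign_mean n f + \<theta>))" using s0 by simp
    then have "0 \<le> K + s * f a" by (simp add: K_def algebra_simps)
    then show "1 \<le> exp K * exp (s * f a)" by (simp flip: exp_add)
  qed simp
  also have "\<dots> \<le> exp K * exp (sign_mean n (\<lambda>a. s * f a) + n * (s * c)\<^sup>2 / 8)"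
    unfolding sign_mean_cmult[of n "exp K"]
    by (intro mult_left_mono exp_mean_bounded_differences)
      (use bd s0 in \<open>auto simp flip: right_diff_distrib simp: abs_mult intro!: mult_left_mono\<close>)
  also have "\<dots> = exp (- s * \<theta> + n * (s * c)\<^sup>2 / 8)"
    by (simp add: K_def sign_mean_cmult algebra_simps flip: exp_add)
  also have "- s * \<theta> + n * (s * c)\<^sup>2 / 8 = - 2 * \<theta>\<^sup>2 / (n * c\<^sup>2)"
    using assms by (simp add: s_def field_simps power2_eq_square)
  finally show ?thesis .
qed

lemma bounded_differences_lower_tail:
  assumes bd: "\<And>a i. a \<in> sign_cube n \<Longrightarrow> i \<in> {1..n} \<Longrightarrow> \<bar>f (a(i := 1)) - f (a(i := - 1))\<bar> \<le> c"
    and "0 < c" "0 < n" "0 \<le> \<theta>"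
  shows "sign_prob n (\<lambda>a. f a \<le> sign_mean n f - \<theta>) \<le> exp (- 2 * \<theta>\<^sup>2 / (n * c\<^sup>2))"
proof -
  have "sign_prob n (\<lambda>a. sign_mean n (\<lambda>a. - f a) + \<theta> \<le> - f a) \<le> exp (- 2 * \<theta>\<^sup>2 / (n * c\<^sup>2))"
    by (rule bounded_differences_upper_tail) (use assms in \<open>auto simp: abs_minus_commute\<close>)
  moreover have "sign_mean n (\<lambda>a. - f a) + \<theta> \<le> - f a \<longleftrightarrow> f a \<le> sign_mean n f - \<theta>" for a
    by (auto simp: sign_mean_uminus)
  ultimately show ?thesis by simp
qed


section \<open>Sums along a pattern as random walks\<close>

text \<open>
  For \<open>s = 0\<close> and \<open>T = {u\<^sub>1, \<dots>, u\<^sub>r}\<close> these are the sums in the definition of the correlation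
  measure. Starting at an arbitrary \<open>s\<close> gives the increments of the walk \<open>e \<mapsto> pattern_sum T 0 e\<close>.
\<close>

definition pattern_sum :: "nat set \<Rightarrow> nat \<Rightarrow> nat \<Rightarrow> (nat \<Rightarrow> int) \<Rightarrow> real" where
  "pattern_sum T s e a = (\<Sum>j\<in>{s<..e}. \<Prod>i\<in>T. of_int (a (j + i)))"

lemma sign_prod_pm1:
  assumes "a \<in> sign_cube n" "finite T" "\<And>i. i \<in> T \<Longrightarrow> 1 \<le> f i \<and> f i \<le> n"
  shows "(\<Prod>i\<in>T. of_int (a (f i)) :: real) = 1 \<or> (\<Prod>i\<in>T. of_int (a (f i)) :: real) = - 1"
  using assms(2,3)
proof (induction T)
  case (insert x T)
  then show ?case using sign_cube_range[OF assms(1), of "f x"] by auto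
qed simp

text \<open>
  With the largest shift \<open>D\<close> singled out, the summand that is completed at time \<open>k\<close> is the fresh
  sign \<open>a k\<close> times a product of earlier signs.
\<close>

lemma pattern_sum_last_factor:
  assumes "W \<subseteq> {..<D}"
  shows "pattern_sum (insert D W) s e a =
    (\<Sum>k\<in>{s + D<..e + D}. of_int (a k) * (\<Prod>i\<in>W. of_int (a (k - D + i))))"
proof -
  have "finite W" "D \<notin> W" using assms finite_subset by auto
  then have "pattern_sum (insert D W) s e a = (\<Sum>j\<in>{s<..e}. of_int (a (j + D)) * (\<Prod>i\<in>W. of_int (a (j + i))))"
    by (simp add: pattern_sum_def)
  also have "\<dots> = (\<Sum>k\<in>{s + D<..e + D}. of_int (a k) * (\<Prod>i\<in>W. of_int (a (k - D + i))))"
    by (rule sum.reindex_bij_witness[of _ "\<lambda>k. k - D" "\<lambda>j. j + D"]) auto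
  finally show ?thesis .
qed

lemma predictable_pattern:
  assumes "W \<subseteq> {..<D}"
  shows "predictable (\<lambda>k a. if k \<in> {s + D<..e + D} then (\<Prod>i\<in>W. real_of_int (a (k - D + i))) else 0)"
  unfolding predictable_def
proof (intro allI impI)
  fix k and a b :: "nat \<Rightarrow> int" assume ab: "\<forall>i<k. a i = b i"
  have "a (k - D + i) = b (k - D + i)" if "k \<in> {s + D<..e + D}" "i \<in> W" for i
    using ab assms that by auto
  then show "(if k \<in> {s + D<..e + D} then (\<Prod>i\<in>W. real_of_int (a (k - D + i))) else 0) =
      (if k \<in> {s + D<..e + D} then (\<Prod>i\<in>W. real_of_int (b (k - D + i))) else 0)"
    by simp
qed

lemma predictable_map: "predictable H \<Longrightarrow> predictable (\<lambda>k a. g (H k a))"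
  unfolding predictable_def by metis

lemma predictable_map2: "predictable H \<Longrightarrow> predictable G \<Longrightarrow> predictable (\<lambda>k a. g (H k a) (G k a))"
  unfolding predictable_def by metis

lemma cosh_pm: "x = 1 \<or> x = - 1 \<Longrightarrow> cosh (t * x) = cosh (t :: real)"
  by auto

text \<open>
  A pattern sum has the exponential moments of a simple random walk with \<open>e - s\<close> steps: the weights
  multiplying the fresh signs are \<open>\<plusminus> t\<close> during the walk and 0 at all other times.
\<close>

lemma exp_mean_pattern_sum:
  assumes "finite T" "T \<noteq> {}" "s \<le> e" "e + Max T \<le> n"
  shows "sign_mean n (\<lambda>a. exp (t * pattern_sum T s e a)) = cosh t ^ (e - s)"
proof -
  define D where "D = Max T"
  define W where "W = T - {D}"
  have T: "T = insert D W" and WD: "W \<subseteq> {..<D}"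
    using Max_in[OF assms(1,2)] Max_ge[OF assms(1)] by (auto simp: W_def D_def order.strict_iff_order)
  have fW: "finite W" using assms by (simp add: W_def)
  define X where "X k a = (if k \<in> {s + D<..e + D} then (\<Prod>i\<in>W. real_of_int (a (k - D + i))) else 0)" for k a
  have sub: "{s + D<..e + D} \<subseteq> {1..n}" using assms by (auto simp: D_def)
  have "(\<Prod>k\<in>{1..n}. exp (of_int (a k) * (t * X k a)) / cosh (t * X k a)) =
      exp (t * pattern_sum T s e a) / cosh t ^ (e - s)" if a: "a \<in> sign_cube n" for a
  proof -
    have "(\<Prod>k\<in>{1..n}. exp (of_int (a k) * (t * X k a)) / cosh (t * X k a)) =
        (\<Prod>k\<in>{s + D<..e + D}. exp (of_int (a k) * (t * X k a)) / cosh (t * X k a))"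
      by (rule prod.mono_neutral_right) (use sub in \<open>auto simp: X_def\<close>)
    also have "\<dots> = (\<Prod>k\<in>{s + D<..e + D}. exp (of_int (a k) * (t * X k a)) / cosh t)"
    proof (rule prod.cong[OF refl])
      fix k assume k: "k \<in> {s + D<..e + D}"
      then have "X k a = 1 \<or> X k a = - 1"
        using sign_prod_pm1[OF a fW, of "\<lambda>i. k - D + i"] WD assms by (force simp: X_def D_def)
      then show "exp (of_int (a k) * (t * X k a)) / cosh (t * X k a) = exp (of_int (a k) * (t * X k a)) / cosh t"
        by (simp add: cosh_pm)
    qed
    also have "\<dots> = exp (\<Sum>k\<in>{s + D<..e + D}. of_int (a k) * (t * X k a)) / cosh t ^ (e - s)"
      by (simp add: prod_dividef exp_sum)
    also have "(\<Sum>k\<in>{s + D<..e + D}. of_int (a k) * (t * X k a)) = t * pattern_sum T s e a"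
      unfolding T pattern_sum_last_factor[OF WD] sum_distrib_left
      by (rule sum.cong) (auto simp: X_def)
    finally show ?thesis .
  qed
  moreover have "predictable (\<lambda>k a. t * X k a)"
    using predictable_map[OF predictable_pattern[OF WD, of s e], of "\<lambda>x. t * x"] by (simp add: X_def)
  ultimately have "sign_mean n (\<lambda>a. exp (t * pattern_sum T s e a) / cosh t ^ (e - s)) = 1"
    using exponential_martingale[of "\<lambda>k a. t * X k a" n] by (simp cong: sign_mean_cong)
  then have "sign_mean n (\<lambda>a. inverse (cosh t ^ (e - s)) * exp (t * pattern_sum T s e a)) = 1"
    by (simp add: field_simps)
  then show ?thesis unfolding sign_mean_cmult
    by (simp add: field_simps)
qed

text \<open>
  Chernoff's bound, with \<open>t = \<theta> / g\<close>. Only an upper bound \<open>g\<close> on the number of steps enters, so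
  that all segments of bounded length get the same estimate.
\<close>

lemma pattern_sum_tail:
  fixes g \<theta> :: real
  assumes "finite T" "T \<noteq> {}" "s \<le> e" "e + Max T \<le> n" "real (e - s) \<le> g" "0 < g" "0 \<le> \<theta>"
  shows "sign_prob n (\<lambda>a. \<theta> \<le> \<bar>pattern_sum T s e a\<bar>) \<le> 2 * exp (- \<theta>\<^sup>2 / (2 * g))"
proof -
  have one: "sign_prob n (\<lambda>a. \<theta> \<le> c * pattern_sum T s e a) \<le> exp (- \<theta>\<^sup>2 / (2 * g))"
    if c: "c = 1 \<or> c = - 1" for c :: real
  proof -
    define t where "t = \<theta> / g"
    have t0: "0 \<le> t" using assms by (simp add: t_def)
    have "sign_prob n (\<lambda>a. \<theta> \<le> c * pattern_sum T s e a) \<le>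
        sign_mean n (\<lambda>a. exp (- t * \<theta>) * exp ((t * c) * pattern_sum T s e a))"
    proof (rule sign_prob_le_mean)
      fix a assume "\<theta> \<le> c * pattern_sum T s e a"
      then have "t * \<theta> \<le> t * (c * pattern_sum T s e a)" using t0 by (rule mult_left_mono)
      then show "1 \<le> exp (- t * \<theta>) * exp ((t * c) * pattern_sum T s e a)"
        by (simp add: algebra_simps flip: exp_add)
    qed simp
    also have "\<dots> = exp (- t * \<theta>) * cosh t ^ (e - s)"
      unfolding sign_mean_cmult using exp_mean_pattern_sum[OF assms(1-4), of "t * c"] c
      by (simp add: cosh_pm)
    also have "\<dots> \<le> exp (- t * \<theta>) * exp (t\<^sup>2 / 2) ^ (e - s)"
      by (intro mult_left_mono power_mono cosh_le_exp_half_square) (auto simp: cosh_real_nonneg)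
    also have "\<dots> = exp (- t * \<theta> + real (e - s) * (t\<^sup>2 / 2))"
      by (simp only: exp_of_nat_mult exp_add)
    also have "\<dots> \<le> exp (- t * \<theta> + g * (t\<^sup>2 / 2))"
      using mult_right_mono[OF assms(5), of "t\<^sup>2 / 2"] by simp
    also have "- t * \<theta> + g * (t\<^sup>2 / 2) = - \<theta>\<^sup>2 / (2 * g)"
      using assms by (simp add: t_def field_simps power2_eq_square)
    finally show ?thesis .
  qed
  have "sign_prob n (\<lambda>a. \<theta> \<le> \<bar>pattern_sum T s e a\<bar>) \<le>
      sign_prob n (\<lambda>a. \<theta> \<le> 1 * pattern_sum T s e a \<or> \<theta> \<le> - 1 * pattern_sum T s e a)"
    by (rule sign_prob_mono) linarith
  also note sign_prob_disj
  finally show ?thesis using one[of 1] one[of "-1"] by simp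
qed

lemma cosh_ge: "1 + x\<^sup>2 / 2 \<le> cosh (x :: real)"
proof -
  have s: "x \<le> sinh x" if "0 \<le> x" for x :: real
  proof -
    have "sinh 0 - 0 \<le> sinh x - x"
    proof (rule DERIV_nonneg_imp_nondecreasing[OF that])
      fix y :: real
      have "((\<lambda>x. sinh x - x) has_real_derivative (cosh y - 1)) (at y)"
        by (auto intro!: derivative_eq_intros)
      then show "\<exists>z. ((\<lambda>x. sinh x - x) has_real_derivative z) (at y) \<and> 0 \<le> z"
        using cosh_real_ge_1[of y] by fastforce
    qed
    then show ?thesis by simp
  qed
  have "\<bar>x / 2\<bar> \<le> sinh \<bar>x / 2\<bar>" by (rule s) simp
  then have "\<bar>x / 2\<bar>\<^sup>2 \<le> (sinh \<bar>x / 2\<bar>)\<^sup>2" by (rule power_mono) simp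
  then have "x\<^sup>2 / 4 \<le> (sinh (x / 2))\<^sup>2" by (cases "0 \<le> x") (auto simp: abs_if power_divide)
  moreover have "cosh x = 1 + 2 * (sinh (x / 2))\<^sup>2"
    using cosh_double[of "x / 2"] by (simp add: cosh_square_eq)
  ultimately show ?thesis by simp
qed

text \<open>
  Together with the Gaussian upper bound this determines \<open>cosh x ^ N\<close> up to a constant factor when
  \<open>N * x ^ 4\<close> is bounded.
\<close>

lemma cosh_power_lower:
  assumes "x\<^sup>2 \<le> 2"
  shows "exp (real N * (x\<^sup>2 / 2 - x ^ 4 / 4)) \<le> cosh x ^ N"
proof -
  have "x\<^sup>2 / 2 - (x\<^sup>2 / 2)\<^sup>2 \<le> ln (1 + x\<^sup>2 / 2)"
    by (rule ln_one_plus_pos_lower_bound) (use assms in auto)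
  then have "x\<^sup>2 / 2 - x ^ 4 / 4 \<le> ln (1 + x\<^sup>2 / 2)" by (simp add: power_divide)
  also have "\<dots> \<le> ln (cosh x)" using cosh_ge[of x] by (simp add: add_pos_nonneg)
  finally have "exp (x\<^sup>2 / 2 - x ^ 4 / 4) \<le> cosh x" by (metis cosh_real_pos exp_le_cancel_iff exp_ln)
  then have "exp (x\<^sup>2 / 2 - x ^ 4 / 4) ^ N \<le> cosh x ^ N" by (rule power_mono) simp
  then show ?thesis by (simp add: exp_of_nat_mult)
qed

text \<open>
  A matching lower bound, up to \<open>\<kappa>\<close> in the exponent, by Cramer's change of measure. Weight the walk
  by \<open>exp (t S)\<close> with \<open>t\<close> chosen so that its mean is about \<open>(\<beta> + \<kappa>) \<sigma> N\<close>, where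
  \<open>\<sigma> = sqrt (2 l / N)\<close>. Under the weight, the walk leaves the window from \<open>\<beta> \<sigma> N\<close> to
  \<open>(\<beta> + 2 \<kappa>) \<sigma> N\<close> with small probability, and inside the window the weight is at most its value at
  the upper end.
\<close>

lemma pattern_sum_tail_lower:
  fixes l \<beta> \<kappa> :: real
  assumes T: "finite T" "T \<noteq> {}" "N + Max T \<le> n"
    and b: "0 \<le> \<beta>" "0 < \<kappa>" "\<beta> + \<kappa> \<le> 1" and l: "7 \<le> l * \<kappa>\<^sup>2" "2 * l\<^sup>2 \<le> N"
  shows "exp (- l * (\<beta> + 2 * \<kappa>)\<^sup>2) / 4 \<le>
    sign_prob n (\<lambda>a. \<beta> * sqrt (2 * l * N) \<le> pattern_sum T 0 N a)"
proof -
  have "\<kappa>\<^sup>2 \<le> 1" using b by (simp add: power_le_one)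
  have "0 < l * \<kappa>\<^sup>2" using l(1) by simp
  then have "0 < l" using b(2) by (simp add: zero_less_mult_iff)
  then have "l * \<kappa>\<^sup>2 \<le> l * 1" using \<open>\<kappa>\<^sup>2 \<le> 1\<close> by (intro mult_left_mono) auto
  then have l1: "1 \<le> l" using l(1) by linarith
  have N: "0 < real N" using l(2) one_le_power[OF l1, of 2] by linarith
  define \<gamma> where "\<gamma> = \<beta> + \<kappa>"
  define \<sigma> where "\<sigma> = sqrt (2 * l / N)"
  have s2: "\<sigma>\<^sup>2 * N = 2 * l" using N l1 by (simp add: \<sigma>_def)
  have s0: "0 < \<sigma>" using N l1 by (simp add: \<sigma>_def)
  have lam: "\<beta> * sqrt (2 * l * N) = \<beta> * \<sigma> * N"
  proof -
    have "(\<sigma> * N)\<^sup>2 = 2 * l * N" using s2 by (simp add: power2_eq_square algebra_simps)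
    then have "sqrt (2 * l * N) = \<sigma> * N" using s0 N by (metis less_imp_le mult_pos_pos real_sqrt_abs abs_of_pos)
    then show ?thesis by simp
  qed
  define t where "t = \<gamma> * \<sigma>"
  define s where "s = \<kappa> * \<sigma>"
  define lo where "lo = \<beta> * \<sigma> * N"
  define hi where "hi = (\<beta> + 2 * \<kappa>) * \<sigma> * N"
  have t0: "0 \<le> t" "0 \<le> s" using b s0 by (auto simp: t_def s_def \<gamma>_def)
  let ?S = "pattern_sum T 0 N"
  have mgf: "sign_mean n (\<lambda>a. exp (x * ?S a)) = cosh x ^ N" for x
    using exp_mean_pattern_sum[OF T(1,2) _ T(3), of 0 x] by simp
  have mgf_le: "cosh x ^ N \<le> exp (N * x\<^sup>2 / 2)" for x :: real
  proof -
    have "cosh x ^ N \<le> exp (x\<^sup>2 / 2) ^ N"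
      by (intro power_mono cosh_le_exp_half_square) (auto simp: cosh_real_nonneg)
    then show ?thesis by (simp flip: exp_of_nat_mult)
  qed
  \<comment> \<open>Below \<open>lo\<close> the first subtracted term dominates \<open>exp (t * S)\<close>, above \<open>hi\<close> the second one does.\<close>
  have "exp (- t * hi) * (exp (t * ?S a) - exp (s * lo) * exp ((t - s) * ?S a) - exp (- s * hi) * exp ((t + s) * ?S a))
      \<le> of_bool (lo \<le> ?S a)" for a
  proof -
    consider "?S a < lo" | "hi < ?S a" "lo \<le> ?S a" | "lo \<le> ?S a" "?S a \<le> hi" by linarith
    then show ?thesis
    proof cases
      case 1
      then have "s * ?S a \<le> s * lo" using t0 by (intro mult_left_mono) auto
      then have "exp (t * ?S a) \<le> exp (s * lo) * exp ((t - s) * ?S a)"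
        by (simp add: algebra_simps flip: exp_add)
      moreover have "0 \<le> exp (- s * hi) * exp ((t + s) * ?S a)" by simp
      ultimately have "exp (- t * hi) * (exp (t * ?S a) - exp (s * lo) * exp ((t - s) * ?S a) - exp (- s * hi) * exp ((t + s) * ?S a)) \<le> 0"
        by (intro mult_nonneg_nonpos exp_ge_zero) linarith
      then show ?thesis using 1 by simp
    next
      case 2
      then have "s * hi \<le> s * ?S a" using t0 by (intro mult_left_mono) auto
      then have "exp (t * ?S a) \<le> exp (- s * hi) * exp ((t + s) * ?S a)"
        by (simp add: algebra_simps flip: exp_add)
      moreover have "0 \<le> exp (s * lo) * exp ((t - s) * ?S a)" by simp
      ultimately have "exp (- t * hi) * (exp (t * ?S a) - exp (s * lo) * exp ((t - s) * ?S a) - exp (- s * hi) * exp ((t + s) * ?S a)) \<le> 0"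
        by (intro mult_nonneg_nonpos exp_ge_zero) linarith
      then show ?thesis using 2 by simp
    next
      case 3
      then have "t * ?S a \<le> t * hi" using t0 by (intro mult_left_mono) auto
      have "0 \<le> exp (s * lo) * exp ((t - s) * ?S a)" "0 \<le> exp (- s * hi) * exp ((t + s) * ?S a)" by simp_all
      then have "exp (- t * hi) * (exp (t * ?S a) - exp (s * lo) * exp ((t - s) * ?S a) - exp (- s * hi) * exp ((t + s) * ?S a))
        \<le> exp (- t * hi) * exp (t * ?S a)"
        by (intro mult_left_mono exp_ge_zero) linarith
      also have "\<dots> \<le> 1" using \<open>t * ?S a \<le> t * hi\<close> by (simp flip: exp_add)
      finally show ?thesis using 3 by simp
    qed
  qed
  then have "sign_mean n (\<lambda>a. exp (- t * hi) * (exp (t * ?S a) + (- exp (s * lo)) * exp ((t - s) * ?S a)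
      + (- exp (- s * hi)) * exp ((t + s) * ?S a))) \<le> sign_prob n (\<lambda>a. lo \<le> ?S a)"
    unfolding sign_prob_def by (intro sign_mean_mono) simp
  then have main: "exp (- t * hi) * (cosh t ^ N - exp (s * lo) * cosh (t - s) ^ N - exp (- s * hi) * cosh (t + s) ^ N)
      \<le> sign_prob n (\<lambda>a. lo \<le> ?S a)"
    by (simp only: sign_mean_cmult sign_mean_add mgf) simp
  \<comment> \<open>Both corrections are smaller than the main term \<open>exp (l * \<gamma>\<^sup>2)\<close> by the factor \<open>exp (- l * \<kappa>\<^sup>2)\<close>.\<close>
  have "exp (s * lo) * cosh (t - s) ^ N \<le> exp (s * lo) * exp (N * (t - s)\<^sup>2 / 2)"
    using mgf_le by simp
  also have "s * lo + N * (t - s)\<^sup>2 / 2 = \<sigma>\<^sup>2 * N * (\<gamma>\<^sup>2 - \<kappa>\<^sup>2) / 2"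
    by (simp add: s_def lo_def t_def \<gamma>_def field_simps power2_eq_square)
  then have "exp (s * lo) * exp (N * (t - s)\<^sup>2 / 2) = exp (l * (\<gamma>\<^sup>2 - \<kappa>\<^sup>2))"
    unfolding s2 by (simp flip: exp_add)
  finally have A: "exp (s * lo) * cosh (t - s) ^ N \<le> exp (l * (\<gamma>\<^sup>2 - \<kappa>\<^sup>2))" .
  have "exp (- s * hi) * cosh (t + s) ^ N \<le> exp (- s * hi) * exp (N * (t + s)\<^sup>2 / 2)"
    using mgf_le by simp
  also have "- s * hi + N * (t + s)\<^sup>2 / 2 = \<sigma>\<^sup>2 * N * (\<gamma>\<^sup>2 - \<kappa>\<^sup>2) / 2"
    by (simp add: s_def hi_def t_def \<gamma>_def field_simps power2_eq_square)
  then have "exp (- s * hi) * exp (N * (t + s)\<^sup>2 / 2) = exp (l * (\<gamma>\<^sup>2 - \<kappa>\<^sup>2))"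
    unfolding s2 by (simp flip: exp_add)
  finally have B: "exp (- s * hi) * cosh (t + s) ^ N \<le> exp (l * (\<gamma>\<^sup>2 - \<kappa>\<^sup>2))" .
  have e7: "2 * exp (- (l * \<kappa>\<^sup>2)) \<le> 1 / 4"
  proof -
    have "8 \<le> exp (7::real)" using exp_ge_add_one_self[of 7] by simp
    also have "\<dots> \<le> exp (l * \<kappa>\<^sup>2)" using l by simp
    finally show ?thesis by (simp add: exp_minus field_simps)
  qed
  have g1: "0 \<le> \<gamma>" "\<gamma> \<le> 1" using b by (auto simp: \<gamma>_def)
  have t2: "t\<^sup>2 = \<gamma>\<^sup>2 * (2 * l / N)" using N l1 by (simp add: t_def \<sigma>_def power_mult_distrib)
  have "2 * l \<le> N" using l(2) self_le_power[OF l1, of 2] by simp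
  then have sm: "2 * l / N \<le> 1" using N by simp
  have "t\<^sup>2 \<le> 1 * 1" unfolding t2 using sm g1 l1 N by (intro mult_mono) (auto simp: power_le_one)
  then have "exp (N * (t\<^sup>2 / 2 - t ^ 4 / 4)) \<le> cosh t ^ N" by (intro cosh_power_lower) simp
  moreover have "N * (t\<^sup>2 / 2 - t ^ 4 / 4) \<ge> l * \<gamma>\<^sup>2 - 1 / 2"
  proof -
    have "t ^ 4 = (t\<^sup>2)\<^sup>2" by simp
    also have "N * ((t\<^sup>2)\<^sup>2 / 4) = \<gamma> ^ 4 * (l\<^sup>2 / N)"
      unfolding t2 using N by (simp add: field_simps power2_eq_square power4_eq_xxxx)
    also have "\<dots> \<le> 1 * (1 / 2)"
      using g1 l N by (intro mult_mono) (auto simp: power_le_one field_simps)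
    finally have "N * (t ^ 4 / 4) \<le> 1 / 2" by simp
    moreover have "N * (t\<^sup>2 / 2) = l * \<gamma>\<^sup>2" unfolding t2 using N by simp
    ultimately show ?thesis by (simp add: right_diff_distrib)
  qed
  ultimately have "exp (l * \<gamma>\<^sup>2 - 1 / 2) \<le> cosh t ^ N" by (meson exp_le_cancel_iff order_trans)
  moreover have "1 / 2 \<le> exp (- (1 / 2) :: real)" using exp_ge_add_one_self[of "- (1 / 2)"] by simp
  then have "exp (l * \<gamma>\<^sup>2) * (1 / 2) \<le> exp (l * \<gamma>\<^sup>2) * exp (- (1 / 2))" by (intro mult_left_mono) auto
  moreover have "exp (l * \<gamma>\<^sup>2) * exp (- (1 / 2)) = exp (l * \<gamma>\<^sup>2 - 1 / 2)" by (simp flip: exp_add)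
  ultimately have C: "exp (l * \<gamma>\<^sup>2) * (1 / 2) \<le> cosh t ^ N" by linarith
  have "exp (l * (\<gamma>\<^sup>2 - \<kappa>\<^sup>2)) = exp (l * \<gamma>\<^sup>2) * exp (- (l * \<kappa>\<^sup>2))"
    by (simp add: algebra_simps flip: exp_add)
  then have "2 * exp (l * (\<gamma>\<^sup>2 - \<kappa>\<^sup>2)) = exp (l * \<gamma>\<^sup>2) * (2 * exp (- (l * \<kappa>\<^sup>2)))" by simp
  also have "\<dots> \<le> exp (l * \<gamma>\<^sup>2) * (1 / 4)" using e7 by (intro mult_left_mono) auto
  finally have "exp (l * \<gamma>\<^sup>2) / 4 \<le> cosh t ^ N - exp (s * lo) * cosh (t - s) ^ N - exp (- s * hi) * cosh (t + s) ^ N"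
    using A B C by linarith
  then have "exp (- t * hi) * (exp (l * \<gamma>\<^sup>2) / 4) \<le> sign_prob n (\<lambda>a. lo \<le> ?S a)"
    by (intro order_trans[OF mult_left_mono main] exp_ge_zero)
  moreover have "- l * (\<beta> + 2 * \<kappa>)\<^sup>2 \<le> - t * hi + l * \<gamma>\<^sup>2"
  proof -
    have "- t * hi = - (\<sigma>\<^sup>2 * N) * \<gamma> * (\<gamma> + \<kappa>)"
      by (simp add: t_def hi_def \<gamma>_def power2_eq_square algebra_simps)
    then have "- t * hi + l * \<gamma>\<^sup>2 = - l * (\<gamma> + \<kappa>)\<^sup>2 + l * \<kappa>\<^sup>2"
      unfolding s2 by (simp add: power2_eq_square algebra_simps)
    moreover have "0 \<le> l * \<kappa>\<^sup>2" using l by simp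
    moreover have "\<gamma> + \<kappa> = \<beta> + 2 * \<kappa>" by (simp add: \<gamma>_def)
    ultimately show ?thesis by simp
  qed
  then have "exp (- l * (\<beta> + 2 * \<kappa>)\<^sup>2) / 4 \<le> exp (- t * hi) * (exp (l * \<gamma>\<^sup>2) / 4)"
    by (simp flip: exp_add)
  ultimately show ?thesis unfolding lam lo_def by linarith
qed

lemma prod_mult_prod_sym_diff:
  fixes f :: "'a \<Rightarrow> 'b :: comm_monoid_mult"
  assumes "finite V" "finite W" "\<And>i. i \<in> V \<inter> W \<Longrightarrow> f i * f i = 1"
  shows "prod f V * prod f W = prod f (sym_diff V W)"
proof -
  have "prod f V = prod f (V - W) * prod f (V \<inter> W)" "prod f W = prod f (W - V) * prod f (V \<inter> W)"
    using assms prod.Int_Diff[of V f W] prod.Int_Diff[of W f V] by (simp_all add: mult.commute Int_commute)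
  then have "prod f V * prod f W = prod f (V - W) * prod f (W - V) * prod (\<lambda>i. f i * f i) (V \<inter> W)"
    by (simp add: prod.distrib mult_ac)
  also have "prod (\<lambda>i. f i * f i) (V \<inter> W) = 1" by (rule prod.neutral) (use assms in auto)
  also have "prod f (V - W) * prod f (W - V) = prod f (sym_diff V W)"
    by (rule prod.union_disjoint[symmetric]) (use assms in auto)
  finally show ?thesis by simp
qed

text \<open>
  The two increments completed at time \<open>k\<close> are \<open>a k * X\<close> and \<open>a k * Y\<close> with predictable signs
  \<open>X\<close> and \<open>Y\<close>, so \<open>ln (cosh (t (X + Y))) \<le> t\<^sup>2 (X + Y)\<^sup>2 / 2 = t\<^sup>2 (1 + X Y)\<close>. The products
  \<open>X Y\<close> add up to the pattern sum of the symmetric difference, since common factors square to 1.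
\<close>

lemma exp_mean_pattern_sum_pair:
  assumes V: "V \<subseteq> {..<D}" and W: "W \<subseteq> {..<D}" and n: "N + D \<le> n"
  shows "sign_mean n (\<lambda>a. exp (t * (pattern_sum (insert D V) 0 N a + pattern_sum (insert D W) 0 N a)
      - t\<^sup>2 * (N + pattern_sum (sym_diff V W) 0 N a))) \<le> 1"
proof -
  have fin: "finite V" "finite W" using assms finite_subset by auto
  define X where "X V k a = (if k \<in> {D<..N + D} then (\<Prod>i\<in>V. real_of_int (a (k - D + i))) else 0)" for V k a
  define H where "H k a = t * (X V k a + X W k a)" for k a
  have "predictable (X V)" "predictable (X W)"
    using predictable_pattern[OF V, of 0 N] predictable_pattern[OF W, of 0 N] by (simp_all add: X_def[abs_def])
  then have pred: "predictable H"
    using predictable_map2[of "X V" "X W" "\<lambda>x y. t * (x + y)"] by (simp add: H_def[abs_def])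
  have "exp (t * (pattern_sum (insert D V) 0 N a + pattern_sum (insert D W) 0 N a)
      - t\<^sup>2 * (N + pattern_sum (sym_diff V W) 0 N a)) \<le> (\<Prod>k\<in>{1..n}. exp (of_int (a k) * H k a) / cosh (H k a))"
    if a: "a \<in> sign_cube n" for a
  proof -
    let ?K = "{D<..N + D}"
    have pm: "X U k a = 1 \<or> X U k a = - 1" if "k \<in> ?K" "U \<subseteq> {..<D}" "finite U" for k U
      using sign_prod_pm1[OF a that(3), of "\<lambda>i. k - D + i"] that n by (force simp: X_def)
    have "pattern_sum (sym_diff V W) 0 N a = (\<Sum>k\<in>?K. X V k a * X W k a)"
    proof -
      have "pattern_sum (sym_diff V W) 0 N a = (\<Sum>j\<in>{0<..N}. (\<Prod>i\<in>V. of_int (a (j + i))) * (\<Prod>i\<in>W. of_int (a (j + i))))"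
        unfolding pattern_sum_def
      proof (intro sum.cong refl prod_mult_prod_sym_diff[symmetric] fin)
        fix j i assume "j \<in> {0<..N}" "i \<in> V \<inter> W"
        then have "a (j + i) = 1 \<or> a (j + i) = - 1"
          using V n by (intro sign_cube_range[OF a]) auto
        then show "real_of_int (a (j + i)) * real_of_int (a (j + i)) = 1" by auto
      qed
      also have "\<dots> = (\<Sum>k\<in>?K. X V k a * X W k a)"
        by (rule sum.reindex_bij_witness[of _ "\<lambda>k. k - D" "\<lambda>j. j + D"]) (auto simp: X_def)
      finally show ?thesis .
    qed
    moreover have "pattern_sum (insert D U) 0 N a = (\<Sum>k\<in>?K. of_int (a k) * X U k a)" if "U \<subseteq> {..<D}" for U
      unfolding pattern_sum_last_factor[OF that] by (rule sum.cong) (auto simp: X_def)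
    moreover have "real N = (\<Sum>k\<in>?K. 1)" by simp
    ultimately have "t * (pattern_sum (insert D V) 0 N a + pattern_sum (insert D W) 0 N a)
        - t\<^sup>2 * (N + pattern_sum (sym_diff V W) 0 N a)
      = (\<Sum>k\<in>?K. of_int (a k) * H k a - t\<^sup>2 * (1 + X V k a * X W k a))"
      using V W by (simp add: H_def sum_subtractf sum.distrib sum_distrib_left algebra_simps)
    also have "\<dots> = (\<Sum>k\<in>?K. of_int (a k) * H k a - (H k a)\<^sup>2 / 2)"
    proof (rule sum.cong[OF refl])
      fix k assume "k \<in> ?K"
      then show "of_int (a k) * H k a - t\<^sup>2 * (1 + X V k a * X W k a) = of_int (a k) * H k a - (H k a)\<^sup>2 / 2"
        using pm[of k V] pm[of k W] V W fin by (auto simp: H_def power2_eq_square)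
    qed
    also have "exp \<dots> = (\<Prod>k\<in>?K. exp (of_int (a k) * H k a) / exp ((H k a)\<^sup>2 / 2))"
      by (simp add: exp_sum exp_diff)
    also have "\<dots> \<le> (\<Prod>k\<in>?K. exp (of_int (a k) * H k a) / cosh (H k a))"
      by (intro prod_mono conjI divide_left_mono cosh_le_exp_half_square) auto
    also have "\<dots> = (\<Prod>k\<in>{1..n}. exp (of_int (a k) * H k a) / cosh (H k a))"
      by (rule prod.mono_neutral_left) (use n in \<open>auto simp: H_def X_def\<close>)
    finally show ?thesis .
  qed
  then have "sign_mean n (\<lambda>a. exp (t * (pattern_sum (insert D V) 0 N a + pattern_sum (insert D W) 0 N a)
      - t\<^sup>2 * (N + pattern_sum (sym_diff V W) 0 N a))) \<le>
    sign_mean n (\<lambda>a. \<Prod>k\<in>{1..n}. exp (of_int (a k) * H k a) / cosh (H k a))"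
    by (rule sign_mean_mono)
  with exponential_martingale[OF pred] show ?thesis by simp
qed

text \<open>
  For different \<open>V\<close> and \<open>W\<close> the symmetric difference is a nonempty pattern, hence its sum \<open>R\<close> is
  itself a random walk and exceeds \<open>\<eta> N\<close> with exponentially small probability. On the remaining
  event the preceding exponential moment with \<open>t = \<beta> sqrt (2 l / N)\<close> gives the bound that
  independent walks would satisfy, up to the factor \<open>exp (2 l \<eta>)\<close>.
\<close>

lemma pattern_sum_joint_tail:
  fixes l \<beta> \<eta> :: real
  assumes V: "V \<subseteq> {..<D}" and W: "W \<subseteq> {..<D}" and "V \<noteq> W" and n: "N + D \<le> n"
    and N: "0 < N" and b: "0 \<le> \<beta>" "\<beta> \<le> 1" and "0 < \<eta>" "0 \<le> l"
  shows "sign_prob n (\<lambda>a. \<beta> * sqrt (2 * l * N) \<le> pattern_sum (insert D V) 0 N a \<and>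
            \<beta> * sqrt (2 * l * N) \<le> pattern_sum (insert D W) 0 N a)
      \<le> 2 * exp (- \<eta>\<^sup>2 * N / 2) + exp (- 2 * l * \<beta>\<^sup>2 + 2 * l * \<eta>)"
proof -
  let ?lam = "\<beta> * sqrt (2 * l * N)"
  let ?S = "\<lambda>V. pattern_sum (insert D V) 0 N"
  let ?R = "pattern_sum (sym_diff V W) 0 N"
  have fin: "finite (sym_diff V W)" using assms finite_subset[of _ "{..<D}"] by auto
  have ne: "sym_diff V W \<noteq> {}" using \<open>V \<noteq> W\<close> by auto
  have "Max (sym_diff V W) < D" using Max_in[OF fin ne] V W by auto
  then have R: "sign_prob n (\<lambda>a. \<eta> * N \<le> \<bar>?R a\<bar>) \<le> 2 * exp (- (\<eta> * N)\<^sup>2 / (2 * real N))"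
    by (intro pattern_sum_tail fin ne) (use n N \<open>0 < \<eta>\<close> in auto)
  have "- (\<eta> * N)\<^sup>2 / (2 * real N) = - \<eta>\<^sup>2 * N / 2" using N by (simp add: field_simps power2_eq_square)
  note R = R[unfolded this]
  define t where "t = \<beta> * sqrt (2 * l / N)"
  have t0: "0 \<le> t" using assms by (simp add: t_def)
  have t2: "t\<^sup>2 * N = 2 * l * \<beta>\<^sup>2" using assms by (simp add: t_def power_mult_distrib)
  have tl: "t * ?lam = 2 * l * \<beta>\<^sup>2"
  proof -
    have "t * ?lam = \<beta>\<^sup>2 * (sqrt (2 * l / N) * sqrt (2 * l * N))" by (simp add: t_def power2_eq_square)
    also have "sqrt (2 * l / N) * sqrt (2 * l * N) = sqrt ((2 * l)\<^sup>2)"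
      using N by (simp add: power2_eq_square flip: real_sqrt_mult)
    also have "\<dots> = 2 * l" using assms by (simp only: real_sqrt_abs)
    finally show ?thesis by simp
  qed
  define K where "K = - 2 * (t * ?lam) + t\<^sup>2 * (N + \<eta> * N)"
  have "sign_prob n (\<lambda>a. \<bar>?R a\<bar> < \<eta> * N \<and> ?lam \<le> ?S V a \<and> ?lam \<le> ?S W a)
      \<le> sign_mean n (\<lambda>a. exp K * exp (t * (?S V a + ?S W a) - t\<^sup>2 * (N + ?R a)))"
  proof (rule sign_prob_le_mean)
    fix a assume a: "\<bar>?R a\<bar> < \<eta> * N \<and> ?lam \<le> ?S V a \<and> ?lam \<le> ?S W a"
    have "t * (?lam + ?lam) \<le> t * (?S V a + ?S W a)" using a t0 by (intro mult_left_mono) auto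
    moreover have "t\<^sup>2 * (N + ?R a) \<le> t\<^sup>2 * (N + \<eta> * N)" using a by (intro mult_left_mono) auto
    ultimately show "1 \<le> exp K * exp (t * (?S V a + ?S W a) - t\<^sup>2 * (N + ?R a))"
      unfolding K_def exp_add[symmetric] one_le_exp_iff by (simp add: distrib_left)
  qed simp
  also have "\<dots> \<le> exp K"
    unfolding sign_mean_cmult using exp_mean_pattern_sum_pair[OF V W n, of t] by simp
  also have "K \<le> - 2 * l * \<beta>\<^sup>2 + 2 * l * \<eta>"
  proof -
    have "K = - 2 * l * \<beta>\<^sup>2 + 2 * l * \<beta>\<^sup>2 * \<eta>"
      unfolding K_def tl distrib_left using t2 by (simp add: algebra_simps)
    moreover have "\<beta>\<^sup>2 * (2 * l * \<eta>) \<le> 1 * (2 * l * \<eta>)"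
      using assms by (intro mult_right_mono) (auto simp: power_le_one)
    ultimately show ?thesis by (simp add: mult_ac)
  qed
  finally have "sign_prob n (\<lambda>a. \<bar>?R a\<bar> < \<eta> * N \<and> ?lam \<le> ?S V a \<and> ?lam \<le> ?S W a)
      \<le> exp (- 2 * l * \<beta>\<^sup>2 + 2 * l * \<eta>)" by simp
  moreover have "sign_prob n (\<lambda>a. ?lam \<le> ?S V a \<and> ?lam \<le> ?S W a) \<le>
     sign_prob n (\<lambda>a. \<eta> * N \<le> \<bar>?R a\<bar> \<or> \<bar>?R a\<bar> < \<eta> * N \<and> ?lam \<le> ?S V a \<and> ?lam \<le> ?S W a)"
    by (rule sign_prob_mono) auto
  ultimately show ?thesis
    using R sign_prob_disj[of n "\<lambda>a. \<eta> * N \<le> \<bar>?R a\<bar>" "\<lambda>a. \<bar>?R a\<bar> < \<eta> * N \<and> ?lam \<le> ?S V a \<and> ?lam \<le> ?S W a"]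
    by linarith
qed


section \<open>The correlation measure as a maximum of pattern sums\<close>

lemma pattern_sum_cong:
  assumes "finite T" "e + Max T \<le> n" "\<And>i. 1 \<le> i \<Longrightarrow> i \<le> n \<Longrightarrow> a i = b i"
  shows "pattern_sum T s e a = pattern_sum T s e b"
  unfolding pattern_sum_def
proof (intro sum.cong prod.cong refl)
  fix j i assume "j \<in> {s<..e}" "i \<in> T"
  then have "1 \<le> j + i" "j + i \<le> n" using Max_ge[OF assms(1), of i] assms(2) by auto
  then show "real_of_int (a (j + i)) = real_of_int (b (j + i))" using assms(3) by simp
qed

lemma pattern_sum_image_shift_tuple:
  assumes "u \<in> shift_tuples r n"
  shows "pattern_sum (u ` {1..r}) 0 m a = of_int (\<Sum>j = 1..m. \<Prod>i = 1..r. a (j + u i))"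
proof -
  have "inj_on u {1..r}" using assms strict_mono_on_imp_inj_on by (auto simp: shift_tuples_def)
  moreover have "{0<..m} = {1..m}" by auto
  ultimately show ?thesis by (simp add: pattern_sum_def prod.reindex)
qed

lemma Max_image_shift_tuple:
  assumes "u \<in> shift_tuples r n" "1 \<le> r"
  shows "Max (u ` {1..r}) = u r"
proof (rule Max_eqI)
  fix y assume "y \<in> u ` {1..r}"
  then obtain i where i: "i \<in> {1..r}" "y = u i" by blast
  have "strict_mono_on {1..r} u" using assms by (simp add: shift_tuples_def)
  then have "mono_on {1..r} u" by (rule strict_mono_on_imp_mono_on)
  then show "y \<le> u r" using i assms(2) mono_onD[of "{1..r}" u i r] by auto
qed (use assms in auto)

lemma shift_tuple_image:
  assumes "T \<subseteq> {..<n}" "card T = r"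
  obtains u where "u \<in> shift_tuples r n" "u ` {1..r} = T"
proof -
  have "finite T" using assms finite_subset by auto
  then obtain h where h: "bij_betw h {..<r} T" "strict_mono_on {..<r} h"
    using ex_bij_betw_strict_mono_card[of T] assms(2) by metis
  define u where "u = restrict (\<lambda>i. h (i - 1)) {1..r}"
  have "(\<lambda>i. i - 1) ` {1..r} = {..<r}"
  proof (intro set_eqI iffI)
    fix x assume "x \<in> {..<r}"
    then show "x \<in> (\<lambda>i. i - 1) ` {1..r}" by (intro image_eqI[of _ _ "x + 1"]) auto
  qed auto
  then have im: "u ` {1..r} = T"
    using bij_betw_imp_surj_on[OF h(1)] unfolding u_def by (metis image_image image_restrict_eq)
  have "strict_mono_on {1..r} u"
  proof (rule strict_mono_onI)
    fix i j assume "i \<in> {1..r}" "j \<in> {1..r}" "i < j"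
    then show "u i < u j" using strict_mono_onD[OF h(2), of "i - 1" "j - 1"] by (auto simp: u_def)
  qed
  then have "u \<in> shift_tuples r n"
    using assms(1) im by (auto simp: shift_tuples_def u_def)
  with im show ?thesis using that by blast
qed

lemma pattern_sum_le_correlation:
  assumes "T \<subseteq> {..<n}" "card T = r" "1 \<le> r" "1 \<le> m" "m + Max T \<le> n"
  shows "\<bar>pattern_sum T 0 m a\<bar> \<le> of_int (correlation_measure r n a)"
proof -
  obtain u where u: "u \<in> shift_tuples r n" "u ` {1..r} = T" by (rule shift_tuple_image[OF assms(1,2)])
  have ur: "u r = Max T" using Max_image_shift_tuple[OF u(1) assms(3)] u(2) by simp
  let ?f = "\<lambda>u m. \<bar>\<Sum>j = 1..m. \<Prod>i = 1..r. a (j + u i)\<bar>"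
  have "?f u m \<le> (MAX m \<in> {1..n - u r}. ?f u m)"
    by (rule Max_ge) (use assms ur in auto)
  also have "\<dots> \<le> correlation_measure r n a"
    unfolding correlation_measure_def by (rule Max_ge) (use u finite_shift_tuples in auto)
  finally have "\<bar>of_int (\<Sum>j = 1..m. \<Prod>i = 1..r. a (j + u i)) :: real\<bar> \<le> of_int (correlation_measure r n a)"
    unfolding of_int_abs[symmetric] of_int_le_iff .
  then show ?thesis
    using pattern_sum_image_shift_tuple[OF u(1), of m a] u(2) by (simp only:)
qed

lemma correlation_attained:
  assumes "1 \<le> r" "r \<le> n"
  obtains T m where "T \<subseteq> {..<n}" "card T = r" "1 \<le> m" "m + Max T \<le> n"
    "of_int (correlation_measure r n a) = \<bar>pattern_sum T 0 m a\<bar>"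
proof -
  let ?f = "\<lambda>u m. \<bar>\<Sum>j = 1..m. \<Prod>i = 1..r. a (j + u i)\<bar>"
  let ?g = "\<lambda>u. MAX m \<in> {1..n - u r}. ?f u m"
  have "correlation_measure r n a \<in> ?g ` shift_tuples r n"
    unfolding correlation_measure_def
    by (rule Max_in) (use assms finite_shift_tuples shift_tuples_nonempty in auto)
  then obtain u where u: "u \<in> shift_tuples r n" "correlation_measure r n a = ?g u" by blast
  have "u r < n" using u(1) assms(1) by (auto simp: shift_tuples_def PiE_iff)
  then have "?g u \<in> ?f u ` {1..n - u r}" by (intro Max_in) auto
  then obtain m where m: "m \<in> {1..n - u r}" "?g u = ?f u m" by blast
  have "inj_on u {1..r}" using u strict_mono_on_imp_inj_on by (auto simp: shift_tuples_def)
  then have "card (u ` {1..r}) = r" by (simp add: card_image)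
  moreover have "u ` {1..r} \<subseteq> {..<n}" using u(1) by (auto simp: shift_tuples_def PiE_iff)
  ultimately show ?thesis
    using that[of "u ` {1..r}" m] m u(2) pattern_sum_image_shift_tuple[OF u(1), of m a]
      Max_image_shift_tuple[OF u(1) assms(1)] \<open>u r < n\<close> by auto
qed

text \<open>
  Every sum that occurs for \<open>n\<close> also occurs for \<open>n'\<close>; needed to pass from a subsequence of lengths
  to all lengths.
\<close>

lemma correlation_mono:
  assumes "1 \<le> r" "r \<le> n" "n \<le> n'" "\<And>i. 1 \<le> i \<Longrightarrow> i \<le> n \<Longrightarrow> a i = b i"
  shows "correlation_measure r n a \<le> correlation_measure r n' b"
proof -
  obtain T m where T: "T \<subseteq> {..<n}" "card T = r" "1 \<le> m" "m + Max T \<le> n"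
    "of_int (correlation_measure r n a) = \<bar>pattern_sum T 0 m a\<bar>"
    by (rule correlation_attained[OF assms(1,2)])
  have "finite T" using T finite_subset by auto
  then have "pattern_sum T 0 m a = pattern_sum T 0 m b" using T(4) assms(4) by (rule pattern_sum_cong)
  moreover have "\<bar>pattern_sum T 0 m b\<bar> \<le> of_int (correlation_measure r n' b)"
    by (rule pattern_sum_le_correlation) (use T assms in auto)
  ultimately show ?thesis using T(5) by simp
qed

text \<open>
  The sign with index \<open>i\<close> occurs only in the summands with \<open>i - j \<in> T\<close>, at most \<open>card T\<close> many,
  and each of them changes by at most 2.
\<close>

lemma pattern_sum_flip:
  assumes "a \<in> sign_cube n" "b \<in> sign_cube n" "finite T" "m + Max T \<le> n"
    and "\<And>k. k \<noteq> i \<Longrightarrow> a k = b k"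
  shows "\<bar>pattern_sum T 0 m a - pattern_sum T 0 m b\<bar> \<le> 2 * card T"
proof -
  let ?p = "\<lambda>c j. \<Prod>k\<in>T. real_of_int (c (j + k))"
  let ?J = "{0<..m} \<inter> (\<lambda>k. i - k) ` T"
  have eq: "?p a j = ?p b j" if "j \<in> {0<..m} - ?J" for j
  proof (intro prod.cong refl)
    fix k assume "k \<in> T"
    then have "j + k \<noteq> i" using that by (auto intro: rev_image_eqI)
    then show "real_of_int (a (j + k)) = real_of_int (b (j + k))" using assms(5) by simp
  qed
  have le2: "\<bar>?p a j - ?p b j\<bar> \<le> 2" if "j \<in> ?J" for j
  proof -
    have jm: "1 \<le> j" "j \<le> m" using that by auto
    have rng: "1 \<le> j + k \<and> j + k \<le> n" if "k \<in> T" for k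
      using Max_ge[OF assms(3) that] jm assms(4) by linarith
    have "?p a j = 1 \<or> ?p a j = - 1" by (rule sign_prod_pm1[OF assms(1,3) rng])
    moreover have "?p b j = 1 \<or> ?p b j = - 1" by (rule sign_prod_pm1[OF assms(2,3) rng])
    ultimately show ?thesis by (elim disjE) simp_all
  qed
  have "\<bar>pattern_sum T 0 m a - pattern_sum T 0 m b\<bar> = \<bar>\<Sum>j\<in>{0<..m}. ?p a j - ?p b j\<bar>"
    by (simp add: pattern_sum_def sum_subtractf)
  also have "(\<Sum>j\<in>{0<..m}. ?p a j - ?p b j) = (\<Sum>j\<in>?J. ?p a j - ?p b j)"
  proof (rule sum.mono_neutral_right)
    show "\<forall>j\<in>{0<..m} - ?J. ?p a j - ?p b j = 0"
      by (intro ballI) (simp only: eq diff_self)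
  qed auto
  also have "\<bar>\<dots>\<bar> \<le> (\<Sum>j\<in>?J. \<bar>?p a j - ?p b j\<bar>)" by (rule sum_abs)
  also have "\<dots> \<le> of_nat (card ?J) * 2" by (rule sum_bounded_above) (rule le2)
  also have "card ?J \<le> card T"
    by (meson assms(3) card_image_le card_mono finite_imageI inf_le2 le_trans)
  finally show ?thesis by simp
qed

lemma correlation_bounded_differences:
  assumes "1 \<le> r" "r \<le> n" "a \<in> sign_cube n" "i \<in> {1..n}"
  shows "\<bar>real_of_int (correlation_measure r n (a(i := 1))) - of_int (correlation_measure r n (a(i := - 1)))\<bar> \<le> 2 * r"
proof -
  have le: "real_of_int (correlation_measure r n b) - of_int (correlation_measure r n c) \<le> 2 * r"
    if bc: "b \<in> sign_cube n" "c \<in> sign_cube n" "\<And>k. k \<noteq> i \<Longrightarrow> b k = c k" for b c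
  proof -
    obtain T m where T: "T \<subseteq> {..<n}" "card T = r" "1 \<le> m" "m + Max T \<le> n"
      "of_int (correlation_measure r n b) = \<bar>pattern_sum T 0 m b\<bar>"
      by (rule correlation_attained[OF assms(1,2)])
    have "finite T" using T finite_subset by auto
    then have "\<bar>pattern_sum T 0 m b - pattern_sum T 0 m c\<bar> \<le> 2 * r"
      using pattern_sum_flip[OF bc(1,2) _ T(4) bc(3)] T(2) by simp
    moreover have "\<bar>pattern_sum T 0 m c\<bar> \<le> of_int (correlation_measure r n c)"
      by (rule pattern_sum_le_correlation) (use T assms in auto)
    ultimately show ?thesis using T(5) by linarith
  qed
  have "a(i := 1) \<in> sign_cube n" "a(i := - 1) \<in> sign_cube n"
    using assms(3,4) by (auto simp: sign_cube_def PiE_iff extensional_def)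
  from le[OF this] le[OF this(2,1)] show ?thesis by (simp add: abs_le_iff)
qed


section \<open>Upper tail of the correlation measure\<close>

text \<open>
  For \<open>p = r - 1\<close> this is asymptotic to the normalization in the theorem, and a factor \<open>\<gamma>\<close> of the
  scale corresponds to the tail probability \<open>n powr (- p \<gamma>\<^sup>2)\<close> of a walk with \<open>n\<close> steps.
\<close>

definition correlation_scale :: "nat \<Rightarrow> nat \<Rightarrow> real" where
  "correlation_scale p n = sqrt (2 * n * (p * ln n))"

lemma pattern_sum_append:
  "s \<le> e \<Longrightarrow> e \<le> f \<Longrightarrow> pattern_sum T s e a + pattern_sum T e f a = pattern_sum T s f a"
  unfolding pattern_sum_def
  by (subst sum.union_disjoint[symmetric]) (auto intro: arg_cong2[where f = sum] simp: ivl_disj_un)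

lemma pattern_sum_translate:
  assumes "finite T" "T \<noteq> {}"
  shows "pattern_sum T 0 m a = pattern_sum ((\<lambda>i. i - Min T) ` T) (Min T) (Min T + m) a"
proof -
  let ?s = "Min T"
  have inj: "inj_on (\<lambda>i. i - ?s) T" using Min_le[OF assms(1)] by (auto intro!: inj_on_diff_nat)
  have "pattern_sum ((\<lambda>i. i - ?s) ` T) ?s (?s + m) a = (\<Sum>j\<in>{?s<..?s + m}. \<Prod>i\<in>T. of_int (a (j + (i - ?s))))"
    by (simp add: pattern_sum_def prod.reindex[OF inj])
  also have "\<dots> = (\<Sum>j\<in>{0<..m}. \<Prod>i\<in>T. of_int (a (j + i)))"
  proof (rule sum.reindex_bij_witness[of _ "\<lambda>j. j + ?s" "\<lambda>j. j - ?s"])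
    fix j assume j: "j \<in> {?s<..?s + m}"
    have "j - ?s + i = j + (i - ?s)" if "i \<in> T" for i using j Min_le[OF assms(1) that] by auto
    then show "(\<Prod>i\<in>T. real_of_int (a (j - ?s + i))) = (\<Prod>i\<in>T. of_int (a (j + (i - ?s))))" by simp
  qed auto
  finally show ?thesis by (simp add: pattern_sum_def)
qed

text \<open>
  Patterns up to translation.
\<close>

definition shapes :: "nat \<Rightarrow> nat \<Rightarrow> nat set set" where
  "shapes r n = {T. T \<subseteq> {..<n} \<and> card T = r \<and> 0 \<in> T}"

lemma finite_shapes: "finite (shapes r n)"
  by (rule finite_subset[of _ "Pow {..<n}"]) (auto simp: shapes_def)

text \<open>
  Normalizing the smallest element to 0 leaves \<open>r - 1\<close> free elements. This is where the exponent
  \<open>r - 1\<close> of the theorem comes from.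
\<close>

lemma card_shapes_le: "card (shapes r n) \<le> n ^ (r - 1)"
proof -
  let ?V = "{V. V \<subseteq> {..<n} \<and> card V = r - 1}"
  have "shapes r n \<subseteq> insert 0 ` ?V"
  proof
    fix T assume "T \<in> shapes r n"
    then have T: "T \<subseteq> {..<n}" "card T = r" "0 \<in> T" by (auto simp: shapes_def)
    then have "T - {0} \<in> ?V" using finite_subset[OF T(1)] by auto
    moreover have "T = insert 0 (T - {0})" using T by auto
    ultimately show "T \<in> insert 0 ` ?V" by (rule rev_image_eqI)
  qed
  then have "card (shapes r n) \<le> card (insert 0 ` ?V)"
    by (intro card_mono finite_imageI) auto
  also have "\<dots> \<le> card ?V" by (rule card_image_le) auto
  also have "\<dots> = n choose (r - 1)" using n_subsets[of "{..<n}" "r - 1"] by simp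
  also have "\<dots> \<le> n ^ (r - 1)"
    by (cases "r - 1 \<le> n") (auto intro: binomial_le_pow simp: binomial_eq_0)
  finally show ?thesis .
qed

text \<open>
  Translating the maximizing pattern by its minimum \<open>s\<close> turns an initial segment of its walk into a
  segment that starts at \<open>s\<close>.
\<close>

lemma correlation_attained_shape:
  assumes "1 \<le> r" "r \<le> n"
  obtains T s e where "T \<in> shapes r n" "s \<le> e" "e + Max T \<le> n"
    "of_int (correlation_measure r n a) = \<bar>pattern_sum T s e a\<bar>"
proof -
  obtain T m where T: "T \<subseteq> {..<n}" "card T = r" "1 \<le> m" "m + Max T \<le> n"
    "of_int (correlation_measure r n a) = \<bar>pattern_sum T 0 m a\<bar>"
    by (rule correlation_attained[OF assms])
  have f: "finite T" and ne: "T \<noteq> {}" using T assms finite_subset by auto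
  let ?s = "Min T"
  let ?T = "(\<lambda>i. i - ?s) ` T"
  have inj: "inj_on (\<lambda>i. i - ?s) T" using Min_le[OF f] by (auto intro!: inj_on_diff_nat)
  have "?T \<in> shapes r n"
    using T card_image[OF inj] Min_in[OF f ne] by (auto simp: shapes_def intro: rev_image_eqI)
  moreover have "?s + m + Max ?T \<le> n"
  proof -
    have "Max ?T \<in> ?T" using f ne by (intro Max_in) auto
    then obtain i where "i \<in> T" "Max ?T = i - ?s" by blast
    moreover have "i \<le> Max T" "?s \<le> i" using f \<open>i \<in> T\<close> by auto
    ultimately show ?thesis using T(4) by linarith
  qed
  ultimately show ?thesis
    using that[of ?T ?s "?s + m"] T(5) pattern_sum_translate[OF f ne, of m a] by simp
qed

lemma shapes_finite: "T \<in> shapes r n \<Longrightarrow> finite T \<and> T \<noteq> {}"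
  unfolding shapes_def using finite_subset by auto

lemma segments_union_bound:
  fixes g x :: real
  assumes "finite I" "\<And>i. i \<in> I \<Longrightarrow> fst i \<le> snd i \<Longrightarrow> real (snd i - fst i) \<le> g" "0 < g" "0 \<le> x"
  shows "sign_prob n (\<lambda>a. \<exists>T\<in>shapes r n. \<exists>i\<in>I. fst i \<le> snd i \<and> snd i + Max T \<le> n \<and>
      x \<le> \<bar>pattern_sum T (fst i) (snd i) a\<bar>) \<le> n ^ (r - 1) * (card I * (2 * exp (- x\<^sup>2 / (2 * g))))"
proof -
  have B: "0 \<le> card I * (2 * exp (- x\<^sup>2 / (2 * g)))" by simp
  have "sign_prob n (\<lambda>a. \<exists>i\<in>I. fst i \<le> snd i \<and> snd i + Max T \<le> n \<and> x \<le> \<bar>pattern_sum T (fst i) (snd i) a\<bar>)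
      \<le> card I * (2 * exp (- x\<^sup>2 / (2 * g)))" if "T \<in> shapes r n" for T
  proof (rule sign_prob_Bex[OF assms(1)])
    fix i assume "i \<in> I"
    show "sign_prob n (\<lambda>a. fst i \<le> snd i \<and> snd i + Max T \<le> n \<and> x \<le> \<bar>pattern_sum T (fst i) (snd i) a\<bar>)
        \<le> 2 * exp (- x\<^sup>2 / (2 * g))"
    proof (cases "fst i \<le> snd i \<and> snd i + Max T \<le> n")
      case True
      then show ?thesis
        using pattern_sum_tail[of T "fst i" "snd i" n g x] shapes_finite[OF that] assms \<open>i \<in> I\<close> by simp
    next
      case False
      then have "sign_prob n (\<lambda>a. fst i \<le> snd i \<and> snd i + Max T \<le> n \<and> x \<le> \<bar>pattern_sum T (fst i) (snd i) a\<bar>) = 0"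
        by (auto simp: sign_prob_def sign_mean_def)
      then show ?thesis by simp
    qed
  qed
  then have "sign_prob n (\<lambda>a. \<exists>T\<in>shapes r n. \<exists>i\<in>I. fst i \<le> snd i \<and> snd i + Max T \<le> n \<and>
      x \<le> \<bar>pattern_sum T (fst i) (snd i) a\<bar>) \<le> card (shapes r n) * (card I * (2 * exp (- x\<^sup>2 / (2 * g))))"
    by (rule sign_prob_Bex[OF finite_shapes])
  also have "\<dots> \<le> n ^ (r - 1) * (card I * (2 * exp (- x\<^sup>2 / (2 * g))))"
    by (intro mult_right_mono of_nat_mono card_shapes_le B)
  finally show ?thesis by simp
qed

text \<open>
  The constants: with \<open>\<delta> = \<epsilon>\<^sup>2 / 40\<close>, a walk with at most \<open>2 \<delta> n\<close> steps exceeds \<open>\<epsilon> / 2\<close> times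
  the scale with probability at most \<open>2 exp (- 5 l)\<close>, where \<open>exp l = n ^ (r - 1)\<close>. That leaves room for
  \<open>exp l\<close> patterns and at most \<open>4 exp (2 l)\<close> segments.
\<close>

lemma correlation_upper_tail:
  assumes r: "2 \<le> r" and e: "0 < \<epsilon>" "\<epsilon> \<le> 1"
  obtains B where "\<And>n. r \<le> n \<Longrightarrow> 40 / \<epsilon>\<^sup>2 \<le> n \<Longrightarrow>
    sign_prob n (\<lambda>a. (1 + 2 * \<epsilon>) * correlation_scale (r - 1) n \<le> of_int (correlation_measure r n a))
      \<le> B * real n powr (- (2 * \<epsilon> * real (r - 1)))"
proof -
  define \<delta> where "\<delta> = \<epsilon>\<^sup>2 / 40"
  have d: "0 < \<delta>" using e by (simp add: \<delta>_def)
  define K where "K = nat \<lceil>1 / \<delta>\<rceil>"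
  have "sign_prob n (\<lambda>a. (1 + 2 * \<epsilon>) * correlation_scale (r - 1) n \<le> of_int (correlation_measure r n a))
      \<le> (2 * (real K + 1)\<^sup>2 + 8) * real n powr (- (2 * \<epsilon> * real (r - 1)))"
    if n: "r \<le> n" "40 / \<epsilon>\<^sup>2 \<le> n" for n
  proof -
    define l where "l = real (r - 1) * ln n"
    let ?L = "correlation_scale (r - 1) n"
    have n2: "2 \<le> n" using n r by simp
    have l: "ln n \<le> l" "0 \<le> l" using r n2 by (auto simp: l_def mult_le_cancel_right1)
    have L: "?L\<^sup>2 = 2 * n * l" "0 \<le> ?L" using l by (auto simp: correlation_scale_def l_def)
    have el: "real n ^ (r - 1) = exp l" using n2 by (simp add: l_def exp_of_nat_mult)
    have pw: "real n powr (- (2 * \<epsilon> * real (r - 1))) = exp (- 2 * \<epsilon> * l)"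
      using n2 by (simp add: powr_def l_def)
    define g where "g = nat \<lceil>\<delta> * n\<rceil>"
    \<comment> \<open>\<open>n\<close> is large enough for rounding \<open>\<delta> * n\<close> up to cost at most a factor 2.\<close>
    have "1 \<le> \<delta> * n" using n(2) e by (simp add: \<delta>_def field_simps)
    then have g: "\<delta> * n \<le> g" "g \<le> 2 * \<delta> * n" "0 < g" unfolding g_def by linarith+
    define I where "I = (\<lambda>(i, j). (g * i, g * j)) ` ({..K} \<times> {..K})"
    define J where "J = {(s, e). s \<le> e \<and> e \<le> n \<and> e - s \<le> g}"
    define bad where "bad X x a \<longleftrightarrow> (\<exists>T\<in>shapes r n. \<exists>i\<in>X. fst i \<le> snd i \<and> snd i + Max T \<le> n \<and>
      x \<le> \<bar>pattern_sum T (fst i) (snd i) a\<bar>)" for X x a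
    have Jsub: "J \<subseteq> {..n} \<times> {..n}" by (auto simp: J_def)
    have fin: "finite I" "finite J" using finite_subset[OF Jsub] by (auto simp: I_def)
    have cI: "card I \<le> (K + 1)\<^sup>2"
      unfolding I_def using card_image_le[of "{..K} \<times> {..K}" "\<lambda>(i, j). (g * i, g * j)"] by (simp add: power2_eq_square)
    have cJ: "card J \<le> (n + 1)\<^sup>2" using card_mono[OF _ Jsub] by (simp add: power2_eq_square)
    \<comment> \<open>Boundedly many grid segments, each with at most \<open>n\<close> steps.\<close>
    have "sign_prob n (bad (I \<inter> {i. snd i \<le> n}) ((1 + \<epsilon>) * ?L)) \<le>
        real n ^ (r - 1) * (card (I \<inter> {i. snd i \<le> n}) * (2 * exp (- ((1 + \<epsilon>) * ?L)\<^sup>2 / (2 * real n))))"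
      unfolding bad_def by (rule segments_union_bound) (use fin L e n2 in auto)
    also have "((1 + \<epsilon>) * ?L)\<^sup>2 / (2 * real n) = (1 + \<epsilon>)\<^sup>2 * l"
      using n2 unfolding power_mult_distrib L by simp
    then have "- ((1 + \<epsilon>) * ?L)\<^sup>2 / (2 * real n) = - ((1 + \<epsilon>)\<^sup>2 * l)" by simp
    also have "real n ^ (r - 1) * (card (I \<inter> {i. snd i \<le> n}) * (2 * exp (- ((1 + \<epsilon>)\<^sup>2 * l)))) \<le>
        exp l * ((real K + 1)\<^sup>2 * (2 * exp (- ((1 + \<epsilon>)\<^sup>2 * l))))"
    proof -
      have "card (I \<inter> {i. snd i \<le> n}) \<le> card I" using fin by (intro card_mono) auto
      then have "card (I \<inter> {i. snd i \<le> n}) \<le> (K + 1)\<^sup>2" using cI by linarith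
      then have "real (card (I \<inter> {i. snd i \<le> n})) \<le> real ((K + 1)\<^sup>2)" by (rule of_nat_mono)
      then have "real (card (I \<inter> {i. snd i \<le> n})) \<le> (real K + 1)\<^sup>2" by (simp add: add.commute)
      then show ?thesis unfolding el by (intro mult_left_mono mult_right_mono) auto
    qed
    also have "\<dots> = 2 * (real K + 1)\<^sup>2 * exp (l - (1 + \<epsilon>)\<^sup>2 * l)"
      by (simp add: exp_diff exp_minus field_simps)
    also have "\<dots> \<le> 2 * (real K + 1)\<^sup>2 * exp (- 2 * \<epsilon> * l)"
    proof -
      have "l - (1 + \<epsilon>)\<^sup>2 * l = - 2 * \<epsilon> * l - \<epsilon>\<^sup>2 * l" by (simp add: power2_eq_square algebra_simps)
      moreover have "0 \<le> \<epsilon>\<^sup>2 * l" using l by simp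
      ultimately show ?thesis by (intro mult_left_mono) auto
    qed
    finally have P1: "sign_prob n (bad (I \<inter> {i. snd i \<le> n}) ((1 + \<epsilon>) * ?L)) \<le> 2 * (real K + 1)\<^sup>2 * exp (- 2 * \<epsilon> * l)" .
    \<comment> \<open>All segments with at most \<open>g\<close> steps, which bound the rounding errors at both ends.\<close>
    have "sign_prob n (bad J (\<epsilon> / 2 * ?L)) \<le>
        real n ^ (r - 1) * (card J * (2 * exp (- (\<epsilon> / 2 * ?L)\<^sup>2 / (2 * real g))))"
      unfolding bad_def by (rule segments_union_bound) (use fin L e g in \<open>auto simp: J_def\<close>)
    also have "\<dots> \<le> exp l * (4 * exp (2 * l) * (2 * exp (- 5 * l)))"
    proof -
      have "real (card J) \<le> real ((n + 1)\<^sup>2)" using cJ by (rule of_nat_mono)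
      also have "\<dots> = (real n + 1)\<^sup>2" by (simp add: add.commute)
      also have "\<dots> \<le> (2 * real n)\<^sup>2" using n2 by (intro power_mono) auto
      also have "\<dots> = 4 * exp (ln n) ^ 2" using n2 by (simp add: power_mult_distrib)
      also have "\<dots> = 4 * exp (2 * ln n)" by (simp flip: exp_of_nat_mult)
      also have "\<dots> \<le> 4 * exp (2 * l)" using l by simp
      finally have cJ': "real (card J) \<le> 4 * exp (2 * l)" .
      have "5 * l * (2 * real g) \<le> 5 * l * (2 * (2 * \<delta> * n))" using g l by (intro mult_left_mono) auto
      also have "\<dots> = (\<epsilon> / 2 * ?L)\<^sup>2" unfolding power_mult_distrib L by (simp add: \<delta>_def power_divide)
      finally have "5 * l \<le> (\<epsilon> / 2 * ?L)\<^sup>2 / (2 * real g)" using g by (simp add: field_simps)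
      then have "exp (- (\<epsilon> / 2 * ?L)\<^sup>2 / (2 * real g)) \<le> exp (- 5 * l)" by simp
      then show ?thesis unfolding el using cJ' by (intro mult_mono mult_left_mono) auto
    qed
    also have "\<dots> = 8 * exp (- 2 * l)" by (simp flip: exp_add)
    also have "\<dots> \<le> 8 * exp (- 2 * \<epsilon> * l)" using e l by (simp add: mult_left_le_one_le)
    finally have P2: "sign_prob n (bad J (\<epsilon> / 2 * ?L)) \<le> 8 * exp (- 2 * \<epsilon> * l)" .
    have "sign_prob n (\<lambda>a. (1 + 2 * \<epsilon>) * ?L \<le> of_int (correlation_measure r n a))
      \<le> sign_prob n (\<lambda>a. bad (I \<inter> {i. snd i \<le> n}) ((1 + \<epsilon>) * ?L) a \<or> bad J (\<epsilon> / 2 * ?L) a)"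
    proof (rule sign_prob_mono, rule ccontr)
      fix a assume big: "(1 + 2 * \<epsilon>) * ?L \<le> of_int (correlation_measure r n a)"
        and "\<not> (bad (I \<inter> {i. snd i \<le> n}) ((1 + \<epsilon>) * ?L) a \<or> bad J (\<epsilon> / 2 * ?L) a)"
      then have good: "\<not> bad (I \<inter> {i. snd i \<le> n}) ((1 + \<epsilon>) * ?L) a" "\<not> bad J (\<epsilon> / 2 * ?L) a" by auto
      obtain T s f where T: "T \<in> shapes r n" "s \<le> f" "f + Max T \<le> n"
        "of_int (correlation_measure r n a) = \<bar>pattern_sum T s f a\<bar>"
        by (rule correlation_attained_shape[OF _ n(1), of a]) (use r in auto)
      define i j where "i = s div g" and "j = f div g"
      have ij: "i \<le> j" using T(2) by (simp add: i_def j_def div_le_mono)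
      have si: "g * i \<le> s" "s - g * i \<le> g" using g(3) by (auto simp: i_def minus_mult_div_eq_mod less_imp_le)
      have fj: "g * j \<le> f" "f - g * j \<le> g" using g(3) by (auto simp: j_def minus_mult_div_eq_mod less_imp_le)
      have "real j \<le> real f / real g" unfolding j_def by (rule of_nat_div_le_of_nat)
      also have "\<dots> \<le> real n / (\<delta> * real n)"
        using T(3) g d n2 by (intro frac_le) auto
      also have "\<dots> = 1 / \<delta>" using n2 by simp
      finally have "j \<le> K" unfolding K_def by linarith
      have "(g * i, g * j) \<in> I \<inter> {i. snd i \<le> n}" using ij \<open>j \<le> K\<close> fj T(3) by (auto simp: I_def)
      moreover have "g * i \<le> g * j \<and> g * j + Max T \<le> n" using ij fj T(3) by auto
      ultimately have m: "\<bar>pattern_sum T (g * i) (g * j) a\<bar> < (1 + \<epsilon>) * ?L"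
        using good(1) T(1) unfolding bad_def by (metis fst_conv snd_conv not_le)
      have J: "\<bar>pattern_sum T u v a\<bar> < \<epsilon> / 2 * ?L" if "u \<le> v" "v \<le> f" "v - u \<le> g" for u v
      proof -
        have "(u, v) \<in> J" "v + Max T \<le> n" using that T(3) by (auto simp: J_def)
        then show ?thesis using good(2) T(1) that(1) unfolding bad_def by (metis fst_conv snd_conv not_le)
      qed
      have "pattern_sum T (g * i) s a + pattern_sum T s f a = pattern_sum T (g * i) (g * j) a + pattern_sum T (g * j) f a"
        using pattern_sum_append[of "g * i" s f T a] pattern_sum_append[of "g * i" "g * j" f T a] si fj T(2) ij by simp
      then have "\<bar>pattern_sum T s f a\<bar> < (1 + \<epsilon>) * ?L + \<epsilon> / 2 * ?L + \<epsilon> / 2 * ?L"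
        using m J[of "g * i" s] J[of "g * j" f] si fj T(2) by linarith
      then show False using big T(4) by (simp add: algebra_simps)
    qed
    also have "\<dots> \<le> 2 * (real K + 1)\<^sup>2 * exp (- 2 * \<epsilon> * l) + 8 * exp (- 2 * \<epsilon> * l)"
      using sign_prob_disj[of n "bad (I \<inter> {i. snd i \<le> n}) ((1 + \<epsilon>) * ?L)" "bad J (\<epsilon> / 2 * ?L)"] P1 P2 by linarith
    finally show ?thesis unfolding pw by (simp add: distrib_right)
  qed
  then show ?thesis using that by blast
qed


section \<open>Lower tail of the correlation measure\<close>

text \<open>
  The number \<open>X\<close> of events that occur equals \<open>X\<close> times the indicator of their union; apply the
  Cauchy-Schwarz inequality to this product.
\<close>

lemma second_moment_union:
  fixes A :: "'b \<Rightarrow> (nat \<Rightarrow> int) \<Rightarrow> bool" and q Q1 Q2 :: real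
  assumes "finite U" "0 \<le> q" "0 \<le> Q2"
    and lo: "\<And>W. W \<in> U \<Longrightarrow> q \<le> sign_prob n (A W)"
    and hi: "\<And>W. W \<in> U \<Longrightarrow> sign_prob n (A W) \<le> Q1"
    and pair: "\<And>V W. V \<in> U \<Longrightarrow> W \<in> U \<Longrightarrow> V \<noteq> W \<Longrightarrow> sign_prob n (\<lambda>a. A V a \<and> A W a) \<le> Q2"
  shows "(card U * q)\<^sup>2 \<le> sign_prob n (\<lambda>a. \<exists>W\<in>U. A W a) * (card U * Q1 + (card U)\<^sup>2 * Q2)"
proof -
  define X :: "(nat \<Rightarrow> int) \<Rightarrow> real" where "X a = (\<Sum>W\<in>U. of_bool (A W a))" for a
  define E where "E = (\<lambda>a. of_bool (\<exists>W\<in>U. A W a) :: real)"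
  have EX: "sign_mean n X = (\<Sum>W\<in>U. sign_prob n (A W))"
    by (simp add: X_def[abs_def] sign_mean_sum sign_prob_def)
  have "card U * q \<le> sign_mean n X"
    unfolding EX using sum_bounded_below[of U q "\<lambda>W. sign_prob n (A W)"] lo by simp
  then have "(card U * q)\<^sup>2 \<le> (sign_mean n X)\<^sup>2" using assms by (intro power_mono) auto
  also have "X = (\<lambda>a. E a * X a)" by (rule ext) (auto simp: X_def E_def)
  then have "(sign_mean n X)\<^sup>2 = (sign_mean n (\<lambda>a. E a * X a))\<^sup>2" by simp
  also have "\<dots> \<le> sign_mean n (\<lambda>a. (E a)\<^sup>2) * sign_mean n (\<lambda>a. (X a)\<^sup>2)"
    by (rule sign_mean_Cauchy_Schwarz)
  also have "sign_mean n (\<lambda>a. (E a)\<^sup>2) = sign_prob n (\<lambda>a. \<exists>W\<in>U. A W a)"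
    unfolding sign_prob_def by (rule sign_mean_cong) (simp add: E_def)
  also have "sign_mean n (\<lambda>a. (X a)\<^sup>2) = (\<Sum>V\<in>U. \<Sum>W\<in>U. sign_prob n (\<lambda>a. A V a \<and> A W a))"
    unfolding X_def power2_eq_square sum_product sign_mean_sum sign_prob_def
    by (intro sum.cong refl sign_mean_cong) auto
  also have "\<dots> \<le> (\<Sum>V\<in>U. Q1 + card U * Q2)"
  proof (rule sum_mono)
    fix V assume V: "V \<in> U"
    have "(\<Sum>W\<in>U. sign_prob n (\<lambda>a. A V a \<and> A W a)) =
        sign_prob n (A V) + (\<Sum>W\<in>U - {V}. sign_prob n (\<lambda>a. A V a \<and> A W a))"
      using V assms(1) by (subst sum.remove[of U V]) auto
    also have "(\<Sum>W\<in>U - {V}. sign_prob n (\<lambda>a. A V a \<and> A W a)) \<le> of_nat (card (U - {V})) * Q2"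
      by (rule sum_bounded_above) (use V pair in auto)
    also have "\<dots> \<le> card U * Q2"
      using assms by (intro mult_right_mono of_nat_mono card_mono) auto
    finally show "(\<Sum>W\<in>U. sign_prob n (\<lambda>a. A V a \<and> A W a)) \<le> Q1 + card U * Q2" using hi[OF V] by simp
  qed
  also have "\<dots> = card U * Q1 + (card U)\<^sup>2 * Q2" by (simp add: power2_eq_square algebra_simps)
  finally show ?thesis by (simp add: mult_left_mono sign_prob_nonneg)
qed

lemma eventually_large_log:
  fixes C c :: real and p :: nat
  assumes "0 < c" "0 < p"
  shows "\<forall>\<^sub>F n :: nat in sequentially. C \<le> c * (p * ln n)"
proof -
  have "filterlim (\<lambda>n :: nat. c * (p * ln n)) at_top sequentially"
    using assms by real_asymp
  then show ?thesis by (simp add: filterlim_at_top)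
qed

lemma eventually_log_square_le:
  fixes c :: real and p :: nat
  assumes "0 < c" "0 < p"
  shows "\<forall>\<^sub>F n :: nat in sequentially. 2 * (p * ln n)\<^sup>2 \<le> c * n"
  using assms by real_asymp

lemma eventually_log_le:
  fixes c C :: real and p :: nat
  assumes "0 < c" "0 < p"
  shows "\<forall>\<^sub>F n :: nat in sequentially. C + 2 * (p * ln n) \<le> c * n"
  using assms by real_asymp

text \<open>
  The choice \<open>\<eta> = \<alpha>\<^sup>2 / (8 r\<^sup>2)\<close> balances two exponents. With \<open>exp l = n ^ p\<close>, the second moment method
  makes \<open>C\<^sub>r\<close> at least \<open>(1 - 2 \<alpha>) L\<close> with probability at least \<open>exp (- 4 l \<eta>) / 64\<close>, while
  \<open>C\<^sub>r\<close> exceeds its mean by \<open>\<alpha> L\<close> with probability at most \<open>exp (- 8 l \<eta>)\<close>. The second number is the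
  smaller one for large \<open>n\<close>, so the mean cannot be below \<open>(1 - 3 \<alpha>) L\<close>.
\<close>

lemma correlation_lower_tail:
  assumes r: "2 \<le> r" and \<alpha>: "0 < \<alpha>" "\<alpha> \<le> 1 / 4"
  shows "\<forall>\<^sub>F n in sequentially.
    sign_prob n (\<lambda>a. of_int (correlation_measure r n a) \<le> (1 - 4 * \<alpha>) * correlation_scale (r - 1) n)
      \<le> real n powr (- (\<alpha>\<^sup>2 * real (r - 1) / (real r)\<^sup>2))"
proof -
  define p where "p = r - 1"
  have p: "0 < p" using r by (simp add: p_def)
  define \<beta> where "\<beta> = 1 - \<alpha>"
  define \<eta> where "\<eta> = \<alpha>\<^sup>2 / (8 * (real r)\<^sup>2)"
  define \<kappa> where "\<kappa> = \<eta> / 8"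
  \<comment> \<open>\<open>c * n ^ p\<close> bounds the number of patterns from below.\<close>
  define c where "c = (\<alpha> / (2 * p)) ^ p"
  have b: "0 \<le> \<beta>" "\<beta> < 1" using \<alpha> by (auto simp: \<beta>_def)
  have b2: "\<beta>\<^sup>2 < 1" using b by (simp add: power_less_one_iff abs_square_less_1)
  have eta: "0 < \<eta>" using \<alpha> r by (simp add: \<eta>_def)
  have c0: "0 < c" using \<alpha> p by (simp add: c_def)
  have "\<eta> \<le> \<alpha>"
  proof -
    have "1 \<le> (real r)\<^sup>2" using r by (intro one_le_power) auto
    then have "1 \<le> 8 * (real r)\<^sup>2" by linarith
    then have "\<alpha>\<^sup>2 / (8 * (real r)\<^sup>2) \<le> \<alpha>\<^sup>2 / 1"
      using r by (intro divide_left_mono) auto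
    also have "\<dots> \<le> \<alpha>" using \<alpha> by (simp add: power2_eq_square mult_left_le)
    finally show ?thesis by (simp add: \<eta>_def)
  qed
  then have kap: "0 < \<kappa>" "\<beta> + \<kappa> \<le> 1" "\<kappa> \<le> 1" using eta \<alpha> by (auto simp: \<kappa>_def \<beta>_def)
  have bk: "(\<beta> + 2 * \<kappa>)\<^sup>2 \<le> \<beta>\<^sup>2 + \<eta>"
  proof -
    have "\<kappa> * (\<beta> + \<kappa>) \<le> \<kappa> * 1" using kap by (intro mult_left_mono) auto
    then show ?thesis using kap by (simp add: power2_eq_square algebra_simps \<kappa>_def)
  qed
  have "\<forall>\<^sub>F n :: nat in sequentially. 7 \<le> \<kappa>\<^sup>2 * (p * ln n)"
    by (rule eventually_large_log) (use kap p in auto)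
  moreover have "\<forall>\<^sub>F n :: nat in sequentially. 2 * (p * ln n)\<^sup>2 \<le> (1 - \<alpha>) * n"
    by (rule eventually_log_square_le) (use \<alpha> p in auto)
  moreover have "\<forall>\<^sub>F n :: nat in sequentially. ln 2 + 2 * (p * ln n) \<le> (\<eta>\<^sup>2 * (1 - \<alpha>) / 2) * n"
    by (rule eventually_log_le) (use \<alpha> eta p in auto)
  moreover have "\<forall>\<^sub>F n :: nat in sequentially. - ln c \<le> (1 - \<beta>\<^sup>2) * (p * ln n)"
    by (rule eventually_large_log) (use b2 p in auto)
  moreover have "\<forall>\<^sub>F n :: nat in sequentially. ln 64 + 1 \<le> (4 * \<eta>) * (p * ln n)"
    by (rule eventually_large_log) (use eta p in auto)
  moreover have "\<forall>\<^sub>F n :: nat in sequentially. nat \<lceil>2 * (p + 1) / \<alpha>\<rceil> \<le> n"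
    by (rule eventually_ge_at_top)
  moreover have "\<forall>\<^sub>F n :: nat in sequentially. r \<le> n"
    by (rule eventually_ge_at_top)
  ultimately show ?thesis
  proof eventually_elim
    case (elim n)
    define l where "l = real p * ln n"
    define D where "D = nat \<lfloor>\<alpha> * n\<rfloor>"
    define N where "N = n - D"
    define U where "U = {W. W \<subseteq> {..<D} \<and> card W = p}"
    define A where "A W a \<longleftrightarrow> \<beta> * sqrt (2 * l * N) \<le> pattern_sum (insert D W) 0 N a" for W a
    define F where "F a = real_of_int (correlation_measure r n a)" for a
    define L where "L = correlation_scale (r - 1) n"
    have n2: "2 \<le> n" using elim r by simp
    have l1: "7 \<le> l * \<kappa>\<^sup>2" using elim by (simp add: l_def mult_ac)
    have l0: "0 \<le> l" using n2 by (simp add: l_def)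
    have "2 * (p + 1) / \<alpha> \<le> n" using elim by linarith
    then have an: "2 * (p + 1) \<le> \<alpha> * n" using \<alpha> by (simp add: field_simps)
    then have an': "2 * real p + 2 \<le> \<alpha> * n" by simp
    then have D: "\<alpha> * n / 2 \<le> D" "D \<le> \<alpha> * n" unfolding D_def by linarith+
    have "p \<le> D" unfolding D_def using an' by (intro le_nat_floor) linarith
    note D = D this
    have Dn: "D < n"
    proof -
      have "\<alpha> * n < 1 * real n" using \<alpha> n2 by (intro mult_strict_right_mono) auto
      then show ?thesis using D(2) by linarith
    qed
    have N: "(1 - \<alpha>) * n \<le> N" "0 < N" "N + D = n" using D(2) Dn by (auto simp: N_def of_nat_diff algebra_simps)
    have Nl: "2 * l\<^sup>2 \<le> N" using elim N by (simp add: l_def)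
    have el: "real n ^ p = exp l" using n2 by (simp add: l_def exp_of_nat_mult)
    have finU: "finite U" by (rule finite_subset[of _ "Pow {..<D}"]) (auto simp: U_def)
    have UD: "W \<subseteq> {..<D}" "finite W" if "W \<in> U" for W
      using that finite_subset[of W "{..<D}"] by (auto simp: U_def)
    have MaxD: "Max (insert D W) = D" if "W \<in> U" for W
      using UD[OF that] by (intro Max_eqI) auto
    have lo: "exp (- l * (\<beta>\<^sup>2 + \<eta>)) / 4 \<le> sign_prob n (A W)" if "W \<in> U" for W
    proof -
      have "exp (- l * (\<beta>\<^sup>2 + \<eta>)) / 4 \<le> exp (- l * (\<beta> + 2 * \<kappa>)\<^sup>2) / 4"
        using mult_left_mono[OF bk l0] by simp
      also have "\<dots> \<le> sign_prob n (A W)"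
        unfolding A_def by (rule pattern_sum_tail_lower) (use UD[OF that] MaxD[OF that] N b kap l1 Nl in auto)
      finally show ?thesis .
    qed
    have hi: "sign_prob n (A W) \<le> 2 * exp (- l * \<beta>\<^sup>2)" if "W \<in> U" for W
    proof -
      have "sign_prob n (A W) \<le> sign_prob n (\<lambda>a. \<beta> * sqrt (2 * l * N) \<le> \<bar>pattern_sum (insert D W) 0 N a\<bar>)"
        by (rule sign_prob_mono) (auto simp: A_def)
      also have "\<dots> \<le> 2 * exp (- (\<beta> * sqrt (2 * l * N))\<^sup>2 / (2 * real N))"
        by (rule pattern_sum_tail) (use UD[OF that] MaxD[OF that] N b l0 in auto)
      also have "- (\<beta> * sqrt (2 * l * N))\<^sup>2 / (2 * real N) = - l * \<beta>\<^sup>2"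
        using N l0 by (simp add: power_mult_distrib)
      finally show ?thesis .
    qed
    have pair: "sign_prob n (\<lambda>a. A V a \<and> A W a) \<le> 2 * exp (- 2 * l * \<beta>\<^sup>2 + 2 * l * \<eta>)"
      if "V \<in> U" "W \<in> U" "V \<noteq> W" for V W
    proof -
      have "sign_prob n (\<lambda>a. A V a \<and> A W a) \<le> 2 * exp (- \<eta>\<^sup>2 * N / 2) + exp (- 2 * l * \<beta>\<^sup>2 + 2 * l * \<eta>)"
        unfolding A_def by (rule pattern_sum_joint_tail) (use UD that N b eta l0 in auto)
      moreover have "2 * exp (- \<eta>\<^sup>2 * N / 2) \<le> exp (- 2 * l * \<beta>\<^sup>2 + 2 * l * \<eta>)"
      proof -
        have "ln 2 + 2 * l \<le> \<eta>\<^sup>2 / 2 * ((1 - \<alpha>) * n)" using elim by (simp add: l_def mult_ac)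
        also have "\<dots> \<le> \<eta>\<^sup>2 / 2 * N" using N by (intro mult_left_mono) auto
        finally have "ln 2 - \<eta>\<^sup>2 * N / 2 \<le> - 2 * l" by simp
        also have "\<dots> \<le> - 2 * l * \<beta>\<^sup>2 + 2 * l * \<eta>"
        proof -
          have "l * \<beta>\<^sup>2 \<le> l * 1" using b2 l0 by (intro mult_left_mono) auto
          moreover have "0 \<le> l * \<eta>" using l0 eta by simp
          ultimately show ?thesis by simp
        qed
        finally have "exp (ln 2 - \<eta>\<^sup>2 * N / 2) \<le> exp (- 2 * l * \<beta>\<^sup>2 + 2 * l * \<eta>)" by simp
        moreover have "ln 2 - \<eta>\<^sup>2 * N / 2 = ln 2 + - \<eta>\<^sup>2 * N / 2" by linarith
        ultimately show ?thesis by (simp only: exp_add exp_ln zero_less_numeral)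
      qed
      ultimately show ?thesis by linarith
    qed
    have cU: "exp (l * \<beta>\<^sup>2) \<le> card U"
    proof -
      have "- ln c \<le> l - l * \<beta>\<^sup>2" using elim by (simp add: l_def algebra_simps)
      then have "exp (l * \<beta>\<^sup>2) \<le> exp (ln c + l)" by simp
      also have "\<dots> = c * real n ^ p" using c0 el by (simp add: exp_add)
      also have "\<dots> = (\<alpha> * n / 2 / p) ^ p" by (simp add: c_def power_mult_distrib[symmetric] mult_ac)
      also have "\<dots> \<le> (real D / p) ^ p"
        using D \<alpha> by (intro power_mono divide_right_mono) auto
      also have "\<dots> \<le> D choose p" by (rule binomial_ge_n_over_k_pow_k[OF D(3)])
      also have "D choose p = card U" unfolding U_def using n_subsets[of "{..<D}" p] by simp
      finally show ?thesis .
    qed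
    \<comment> \<open>Since \<open>card U * y \<ge> 1\<close>, the diagonal of the second moment is no larger than the off-diagonal part.\<close>
    have main: "exp (- 4 * l * \<eta>) / 64 \<le> sign_prob n (\<lambda>a. \<exists>W\<in>U. A W a)"
    proof -
      let ?P = "sign_prob n (\<lambda>a. \<exists>W\<in>U. A W a)"
      define u where "u = real (card U)"
      define y where "y = exp (- l * \<beta>\<^sup>2)"
      define z where "z = exp (l * \<eta>)"
      have y: "0 < y" "1 \<le> u * y" using cU by (auto simp: y_def u_def exp_minus field_simps)
      have z: "1 \<le> z" using l0 eta by (simp add: z_def)
      have "(u * (y / z / 4))\<^sup>2 \<le> ?P * (u * (2 * y) + u\<^sup>2 * (2 * (y\<^sup>2 * z\<^sup>2)))"
      proof -
        have e1: "exp (- l * (\<beta>\<^sup>2 + \<eta>)) = y / z"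
          by (simp add: y_def z_def algebra_simps flip: exp_diff)
        have e2: "exp (- 2 * l * \<beta>\<^sup>2 + 2 * l * \<eta>) = y\<^sup>2 * z\<^sup>2"
          by (simp add: y_def z_def algebra_simps flip: exp_of_nat_mult exp_add)
        have "(card U * (exp (- l * (\<beta>\<^sup>2 + \<eta>)) / 4))\<^sup>2 \<le> ?P * (card U * (2 * exp (- l * \<beta>\<^sup>2))
            + (card U)\<^sup>2 * (2 * exp (- 2 * l * \<beta>\<^sup>2 + 2 * l * \<eta>)))"
          by (rule second_moment_union[OF finU _ _ lo hi pair]) auto
        then show ?thesis unfolding e1 e2 u_def y_def by simp
      qed
      also have "\<dots> \<le> ?P * (4 * (u * y * z)\<^sup>2)"
      proof (rule mult_left_mono)
        have uy: "u * y \<le> (u * y)\<^sup>2" using y self_le_power[of "u * y" 2] by simp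
        have "(u * y)\<^sup>2 * 1 \<le> (u * y)\<^sup>2 * z\<^sup>2" using z by (intro mult_left_mono) auto
        then show "u * (2 * y) + u\<^sup>2 * (2 * (y\<^sup>2 * z\<^sup>2)) \<le> 4 * (u * y * z)\<^sup>2"
          using uy by (simp add: power_mult_distrib)
      qed (rule sign_prob_nonneg)
      finally have "(u * y)\<^sup>2 * (1 / (16 * z\<^sup>2)) \<le> (u * y)\<^sup>2 * (?P * (4 * z\<^sup>2))"
        by (simp add: power_mult_distrib power_divide mult_ac)
      moreover have "0 < (u * y)\<^sup>2" using y by (intro zero_less_power) linarith
      ultimately have "1 / (16 * z\<^sup>2) \<le> ?P * (4 * z\<^sup>2)" by (rule mult_left_le_imp_le)
      then have "1 / (64 * (z\<^sup>2 * z\<^sup>2)) \<le> ?P" using z by (simp add: field_simps)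
      moreover have "z\<^sup>2 * z\<^sup>2 = exp (4 * l * \<eta>)" by (simp add: z_def flip: exp_of_nat_mult exp_add)
      ultimately show ?thesis by (simp add: exp_minus field_simps)
    qed
    have L: "L\<^sup>2 = 2 * n * l" "0 \<le> L" using l0 by (auto simp: L_def correlation_scale_def l_def p_def)
    have lam: "(1 - 2 * \<alpha>) * L \<le> \<beta> * sqrt (2 * l * N)"
    proof -
      have "(1 - \<alpha>) * L = sqrt ((1 - \<alpha>)\<^sup>2 * (2 * n * l))"
        unfolding L(1)[symmetric] using \<alpha> L(2) by (simp add: real_sqrt_mult)
      also have "\<dots> \<le> sqrt (2 * l * N)"
      proof (rule real_sqrt_le_mono)
        have "(1 - \<alpha>)\<^sup>2 * n \<le> (1 - \<alpha>) * n" using \<alpha> by (intro mult_right_mono) (auto simp: power2_eq_square mult_left_le)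
        also have "\<dots> \<le> N" by (rule N)
        finally have "2 * l * ((1 - \<alpha>)\<^sup>2 * n) \<le> 2 * l * N" using l0 by (intro mult_left_mono) auto
        then show "(1 - \<alpha>)\<^sup>2 * (2 * n * l) \<le> 2 * l * N" by (simp add: mult_ac)
      qed
      finally have "\<beta> * ((1 - \<alpha>) * L) \<le> \<beta> * sqrt (2 * l * N)" using b(1) by (rule mult_left_mono)
      moreover have "\<beta> * ((1 - \<alpha>) * L) = (1 - 2 * \<alpha>) * L + \<alpha>\<^sup>2 * L" by (simp add: \<beta>_def power2_eq_square algebra_simps)
      moreover have "0 \<le> \<alpha>\<^sup>2 * L" using L by simp
      ultimately show ?thesis by linarith
    qed
    have big: "sign_prob n (\<lambda>a. \<exists>W\<in>U. A W a) \<le> sign_prob n (\<lambda>a. (1 - 2 * \<alpha>) * L \<le> F a)"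
    proof (rule sign_prob_mono)
      fix a assume "\<exists>W\<in>U. A W a"
      then obtain W where W: "W \<in> U" "A W a" by blast
      have "D \<notin> W" using UD[OF W(1)] by auto
      then have "card (insert D W) = r" using W(1) UD[OF W(1)] r by (simp add: U_def p_def)
      moreover have "insert D W \<subseteq> {..<n}" using UD[OF W(1)] Dn by auto
      ultimately have "\<bar>pattern_sum (insert D W) 0 N a\<bar> \<le> F a"
        unfolding F_def by (intro pattern_sum_le_correlation) (use r N MaxD[OF W(1)] in auto)
      then show "(1 - 2 * \<alpha>) * L \<le> F a" using W(2) lam by (simp add: A_def)
    qed
    have bd: "\<bar>F (a(i := 1)) - F (a(i := - 1))\<bar> \<le> 2 * real r" if "a \<in> sign_cube n" "i \<in> {1..n}" for a i
      using correlation_bounded_differences[OF _ _ that, of r] r elim by (simp add: F_def)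
    have conc: "- 2 * (\<alpha> * L)\<^sup>2 / (n * (2 * real r)\<^sup>2) = - 8 * l * \<eta>"
    proof -
      have "- 2 * (\<alpha> * L)\<^sup>2 / (n * (2 * real r)\<^sup>2) = - 2 * (\<alpha>\<^sup>2 * (2 * n * l)) / (n * (4 * (real r)\<^sup>2))"
        unfolding power_mult_distrib L by simp
      also have "\<dots> = - 8 * l * \<eta>" unfolding \<eta>_def using n2 r by (simp add: field_simps)
      finally show ?thesis .
    qed
    have mean: "(1 - 3 * \<alpha>) * L \<le> sign_mean n F"
    proof (rule ccontr)
      assume small: "\<not> (1 - 3 * \<alpha>) * L \<le> sign_mean n F"
      have "sign_prob n (\<lambda>a. (1 - 2 * \<alpha>) * L \<le> F a) \<le> sign_prob n (\<lambda>a. sign_mean n F + \<alpha> * L \<le> F a)"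
        by (rule sign_prob_mono) (use small in \<open>auto simp: algebra_simps\<close>)
      also have "\<dots> \<le> exp (- 2 * (\<alpha> * L)\<^sup>2 / (n * (2 * real r)\<^sup>2))"
        by (rule bounded_differences_upper_tail) (use bd r n2 \<alpha> L in auto)
      finally have "exp (- 4 * l * \<eta>) / 64 \<le> exp (- 8 * l * \<eta>)" using main big conc by simp
      also have "\<dots> = exp (- 4 * l * \<eta>) * exp (- 4 * l * \<eta>)" by (simp flip: exp_add)
      finally have "exp (- 4 * l * \<eta>) * (1 / 64) \<le> exp (- 4 * l * \<eta>) * exp (- 4 * l * \<eta>)" by simp
      then have "1 / 64 \<le> exp (- 4 * l * \<eta>)" by (rule mult_left_le_imp_le) simp
      then have "exp (4 * l * \<eta>) \<le> 64" by (simp add: exp_minus field_simps)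
      moreover have "exp (ln 64 + 1) \<le> exp (4 * l * \<eta>)" using elim by (simp add: l_def mult_ac)
      moreover have "(64 :: real) < exp (ln 64 + 1)" by (simp add: exp_add)
      ultimately show False by linarith
    qed
    have "sign_prob n (\<lambda>a. F a \<le> (1 - 4 * \<alpha>) * L) \<le> sign_prob n (\<lambda>a. F a \<le> sign_mean n F - \<alpha> * L)"
      by (rule sign_prob_mono) (use mean in \<open>auto simp: algebra_simps\<close>)
    also have "\<dots> \<le> exp (- 2 * (\<alpha> * L)\<^sup>2 / (n * (2 * real r)\<^sup>2))"
      by (rule bounded_differences_lower_tail) (use bd r n2 \<alpha> L in auto)
    also have "- 2 * (\<alpha> * L)\<^sup>2 / (n * (2 * real r)\<^sup>2) = - (\<alpha>\<^sup>2 * p / (real r)\<^sup>2) * ln n"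
      unfolding conc using r by (simp add: \<eta>_def l_def field_simps)
    also have "exp \<dots> = real n powr (- (\<alpha>\<^sup>2 * p / (real r)\<^sup>2))" using n2 by (simp add: powr_def)
    finally show ?case by (simp add: F_def L_def p_def)
  qed
qed


section \<open>Almost sure convergence\<close>

text \<open>
  An event in the first \<open>n\<close> coordinates is a finite disjoint union of cylinders of equal probability,
  so the prescribed cylinder probabilities turn it into a count over the sign vectors of length \<open>n\<close>.
\<close>

lemma initial_segment_event:
  fixes M :: "(nat \<Rightarrow> int) measure"
  assumes "prob_space M" and S: "sets M = sets sign_sequences"
    and cyl: "\<And>n c. n \<ge> 1 \<Longrightarrow> c \<in> {1..n} \<rightarrow>\<^sub>E {-1, 1} \<Longrightarrow>
           \<P>(a in M. \<forall>i\<in>{1..n}. a i = c i) = 1 / 2 ^ n"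
  shows "{a \<in> space M. Q (initial_segment n a)} \<in> sets M"
    and "1 \<le> n \<Longrightarrow> \<P>(a in M. Q (initial_segment n a)) = sign_prob n Q"
proof -
  interpret prob_space M by fact
  have sp: "space M = {1..} \<rightarrow>\<^sub>E {-1, 1}"
    using sets_eq_imp_space_eq[OF S] by (simp add: space_sign_sequences)
  define cylinder where "cylinder c = {a \<in> space M. \<forall>i\<in>{1..n}. a i = c i}" for c :: "nat \<Rightarrow> int"
  define G where "G = {c \<in> sign_cube n. Q c}"
  have fG: "finite G" by (simp add: G_def finite_sign_cube)
  have seg: "initial_segment n a = c \<longleftrightarrow> (\<forall>i\<in>{1..n}. a i = c i)" if "c \<in> sign_cube n" for a c
    using that by (auto simp: initial_segment_def sign_cube_def PiE_def extensional_def fun_eq_iff)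
  have cube: "initial_segment n a \<in> sign_cube n" if "a \<in> space M" for a
    using that unfolding sp initial_segment_def sign_cube_def by (force simp: PiE_iff)
  have ev: "{a \<in> space M. Q (initial_segment n a)} = (\<Union>c\<in>G. cylinder c)"
  proof (intro set_eqI iffI)
    fix a assume "a \<in> {a \<in> space M. Q (initial_segment n a)}"
    then show "a \<in> (\<Union>c\<in>G. cylinder c)"
      using cube[of a] seg[of "initial_segment n a" a] by (auto simp: G_def cylinder_def)
  next
    fix a assume "a \<in> (\<Union>c\<in>G. cylinder c)"
    then obtain c where "c \<in> G" "a \<in> cylinder c" by blast
    then show "a \<in> {a \<in> space M. Q (initial_segment n a)}"
      using seg[of c a] by (auto simp: G_def cylinder_def)
  qed
  have comp: "(\<lambda>a. a i) \<in> measurable M (count_space {-1, 1})" if "i \<in> {1..n}" for i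
  proof -
    have "(\<lambda>a. a i) \<in> measurable sign_sequences (count_space {-1, 1})"
      unfolding sign_sequences_def by (rule measurable_component_singleton) (use that in auto)
    then show ?thesis using measurable_cong_sets[OF S refl] by blast
  qed
  have meas: "cylinder c \<in> sets M" if "c \<in> sign_cube n" for c
  proof -
    have "{a \<in> space M. a i = c i} \<in> sets M" if i: "i \<in> {1..n}" for i
    proof -
      have "c i \<in> {-1, 1}" using \<open>c \<in> sign_cube n\<close> i by (auto simp: sign_cube_def PiE_iff)
      then have "(\<lambda>a. a i) -` {c i} \<inter> space M \<in> sets M" by (intro measurable_sets[OF comp[OF i]]) auto
      moreover have "(\<lambda>a. a i) -` {c i} \<inter> space M = {a \<in> space M. a i = c i}" by auto
      ultimately show ?thesis by simp
    qed
    then show ?thesis unfolding cylinder_def by (intro sets.sets_Collect_finite_All) auto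
  qed
  show "{a \<in> space M. Q (initial_segment n a)} \<in> sets M"
    unfolding ev by (intro sets.finite_UN fG) (auto simp: G_def intro: meas)
  assume n: "1 \<le> n"
  have "measure M (\<Union>c\<in>G. cylinder c) = (\<Sum>c\<in>G. measure M (cylinder c))"
  proof (rule finite_measure_finite_Union[OF fG])
    show "cylinder ` G \<subseteq> sets M" by (auto simp: G_def intro: meas)
    show "disjoint_family_on cylinder G"
      unfolding disjoint_family_on_def
    proof (intro ballI impI equals0I)
      fix c d a assume "c \<in> G" "d \<in> G" "c \<noteq> d" "a \<in> cylinder c \<inter> cylinder d"
      then show False using seg[of c a] seg[of d a] by (auto simp: G_def cylinder_def)
    qed
  qed
  also have "\<dots> = (\<Sum>c\<in>G. 1 / 2 ^ n)"
    by (intro sum.cong refl) (use cyl[OF n] in \<open>auto simp: cylinder_def G_def sign_cube_def\<close>)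
  also have "\<dots> = sign_prob n Q"
  proof -
    have "G = sign_cube n \<inter> {c. Q c}" by (auto simp: G_def)
    then show ?thesis
      by (simp add: sign_prob_def sign_mean_def finite_sign_cube of_bool_def sum.If_cases)
  qed
  finally show "\<P>(a in M. Q (initial_segment n a)) = sign_prob n Q" unfolding ev .
qed

text \<open>
  Borel-Cantelli along \<open>n = k\<^sup>q\<close>: however small the exponent \<open>c\<close> is, the bounds become summable as
  soon as \<open>q * c > 1\<close>.
\<close>

lemma AE_eventually_power_subsequence:
  fixes M :: "(nat \<Rightarrow> int) measure" and c :: real
  assumes M: "prob_space M" "sets M = sets sign_sequences"
    "\<And>n c. n \<ge> 1 \<Longrightarrow> c \<in> {1..n} \<rightarrow>\<^sub>E {-1, 1} \<Longrightarrow>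
           \<P>(a in M. \<forall>i\<in>{1..n}. a i = c i) = 1 / 2 ^ n"
    and q: "1 \<le> q" "1 < q * c"
    and bound: "\<forall>\<^sub>F n in sequentially. sign_prob n (Q n) \<le> B * real n powr (- c)"
  shows "AE a in M. \<forall>\<^sub>F k in sequentially. \<not> Q (k ^ q) (initial_segment (k ^ q) a)"
proof -
  interpret prob_space M by fact
  define A where "A k = {a \<in> space M. Q (k ^ q) (initial_segment (k ^ q) a)}" for k
  have A: "A k \<in> sets M" for k
    unfolding A_def by (rule initial_segment_event(1)[OF M])
  have lim: "filterlim (\<lambda>k::nat. k ^ q) sequentially sequentially"
  proof (rule filterlim_at_top_mono[OF filterlim_ident])
    show "\<forall>\<^sub>F k :: nat in sequentially. k \<le> k ^ q"
      using eventually_ge_at_top[of 1] by eventually_elim (use q in \<open>simp add: self_le_power\<close>)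
  qed
  have "\<forall>\<^sub>F k in sequentially. norm (measure M (A k)) \<le> B * real k powr (- (q * c))"
    using eventually_compose_filterlim[OF bound lim] eventually_ge_at_top[of 1]
  proof eventually_elim
    case (elim k)
    have "measure M (A k) = sign_prob (k ^ q) (Q (k ^ q))"
      unfolding A_def using elim by (intro initial_segment_event(2)[OF M]) auto
    also have "\<dots> \<le> B * real (k ^ q) powr (- c)" by (rule elim)
    also have "real (k ^ q) powr (- c) = real k powr (- (q * c))"
      using elim by (simp add: powr_powr flip: powr_realpow)
    finally show ?case by simp
  qed
  moreover have "summable (\<lambda>k. B * real k powr (- (q * c)))"
    using q by (intro summable_mult) (simp add: summable_real_powr_iff)
  ultimately have "summable (\<lambda>k. measure M (A k))" by (rule summable_comparison_test_ev)
  then have "AE a in M. \<forall>\<^sub>F k in sequentially. a \<in> space M - A k"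
    by (intro borel_cantelli_AE1 A) (auto simp: emeasure_eq_measure)
  then show ?thesis
  proof (rule AE_mp)
    show "AE a in M. (\<forall>\<^sub>F k in sequentially. a \<in> space M - A k) \<longrightarrow>
        (\<forall>\<^sub>F k in sequentially. \<not> Q (k ^ q) (initial_segment (k ^ q) a))"
      by (rule AE_I2) (auto simp: A_def elim: eventually_mono)
  qed
qed

lemma between_consecutive_powers:
  assumes "1 \<le> q"
  obtains k where "k ^ q \<le> n" "n < Suc k ^ q"
proof -
  have "\<exists>k. k ^ q \<le> n \<and> n < Suc k ^ q"
  proof (induction n)
    case 0
    show ?case using assms by (intro exI[of _ 0]) auto
  next
    case (Suc n)
    then obtain k where k: "k ^ q \<le> n" "n < Suc k ^ q" by blast
    show ?case
    proof (cases "Suc n < Suc k ^ q")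
      case True
      then show ?thesis using k by (intro exI[of _ k]) auto
    next
      case False
      moreover have "Suc k ^ q < Suc (Suc k) ^ q" using assms by (intro power_strict_mono) auto
      ultimately show ?thesis using k by (intro exI[of _ "Suc k"]) auto
    qed
  qed
  then show ?thesis using that by blast
qed

text \<open>
  For \<open>k\<^sup>q \<le> n < (k + 1)\<^sup>q\<close>, monotonicity compares \<open>F n\<close> and \<open>L n\<close> with their values at the two
  neighbouring powers, and these values of \<open>L\<close> differ by a factor at most \<open>1 + \<epsilon>\<close>.
\<close>

lemma ratio_bound_from_powers:
  fixes F L :: "nat \<Rightarrow> real"
  assumes e: "0 < \<epsilon>" "\<epsilon> \<le> 1" and q: "1 \<le> q"
    and mono: "\<And>m n. n0 \<le> m \<Longrightarrow> m \<le> n \<Longrightarrow> F m \<le> F n" "\<And>m n. n0 \<le> m \<Longrightarrow> m \<le> n \<Longrightarrow> L m \<le> L n"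
    and pos: "\<And>n. n0 \<le> n \<Longrightarrow> 0 < L n"
    and ratio: "(\<lambda>k. L (Suc k ^ q) / L (k ^ q)) \<longlonglongrightarrow> 1"
    and up: "\<forall>\<^sub>F k in sequentially. F (k ^ q) \<le> (1 + \<epsilon>) * L (k ^ q)"
    and lo: "\<forall>\<^sub>F k in sequentially. (1 - \<epsilon>) * L (k ^ q) \<le> F (k ^ q)"
  shows "\<forall>\<^sub>F n in sequentially. \<bar>F n / L n - 1\<bar> \<le> 3 * \<epsilon>"
proof -
  have "\<forall>\<^sub>F k in sequentially. L (Suc k ^ q) / L (k ^ q) < 1 + \<epsilon>"
    by (rule order_tendstoD[OF ratio]) (use e in auto)
  then have "\<forall>\<^sub>F k in sequentially. L (Suc k ^ q) / L (k ^ q) < 1 + \<epsilon> \<and>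
      F (k ^ q) \<le> (1 + \<epsilon>) * L (k ^ q) \<and> (1 - \<epsilon>) * L (k ^ q) \<le> F (k ^ q) \<and> max 1 n0 \<le> k"
    using up lo eventually_ge_at_top[of "max 1 n0"] by eventually_elim auto
  then obtain K where K: "\<And>k. K \<le> k \<Longrightarrow> L (Suc k ^ q) / L (k ^ q) < 1 + \<epsilon> \<and>
      F (k ^ q) \<le> (1 + \<epsilon>) * L (k ^ q) \<and> (1 - \<epsilon>) * L (k ^ q) \<le> F (k ^ q) \<and> max 1 n0 \<le> k"
    unfolding eventually_sequentially by blast
  show ?thesis
    using eventually_ge_at_top[of "Suc K ^ q"]
  proof eventually_elim
    case (elim n)
    obtain k where k: "k ^ q \<le> n" "n < Suc k ^ q" by (rule between_consecutive_powers[OF q])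
    have "Suc K ^ q < Suc k ^ q" using elim k by linarith
    then have "K \<le> k" by (metis Suc_less_eq less_imp_le power_less_imp_less_base zero_le)
    note Kk = K[OF this] K[of "Suc k"]
    have n0: "n0 \<le> k ^ q" using Kk(1) self_le_power[of k q] q by simp
    have Lk: "0 < L (k ^ q)" and Ln: "0 < L n" using pos n0 k by auto
    have r: "L (Suc k ^ q) \<le> (1 + \<epsilon>) * L (k ^ q)" using Kk(1) Lk by (simp add: field_simps)
    have "F n \<le> F (Suc k ^ q)" using mono(1)[of n "Suc k ^ q"] n0 k by simp
    also have "\<dots> \<le> (1 + \<epsilon>) * L (Suc k ^ q)" using Kk(2) \<open>K \<le> k\<close> by simp
    also have "\<dots> \<le> (1 + \<epsilon>) * ((1 + \<epsilon>) * L n)"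
      using r mono(2)[OF n0 k(1)] e by (intro mult_left_mono) (auto elim: order_trans intro: mult_left_mono)
    also have "\<dots> \<le> (1 + 3 * \<epsilon>) * L n"
    proof -
      have "(1 + \<epsilon>) * (1 + \<epsilon>) \<le> 1 + 3 * \<epsilon>" using e by (simp add: algebra_simps mult_left_le)
      then have "(1 + \<epsilon>) * (1 + \<epsilon>) * L n \<le> (1 + 3 * \<epsilon>) * L n" using Ln by (intro mult_right_mono) auto
      then show ?thesis by (simp add: mult_ac)
    qed
    finally have u: "F n / L n \<le> 1 + 3 * \<epsilon>" using Ln by (simp add: field_simps)
    have "(1 - 3 * \<epsilon>) * L n \<le> (1 - \<epsilon>) * L (k ^ q)"
    proof -
      have "L n \<le> (1 + \<epsilon>) * L (k ^ q)" using r mono(2)[of n "Suc k ^ q"] n0 k by simp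
      then have "(1 - \<epsilon>) * L n \<le> (1 - \<epsilon>) * ((1 + \<epsilon>) * L (k ^ q))" using e by (intro mult_left_mono) auto
      moreover have "L (k ^ q) \<le> L n" by (rule mono(2)[OF n0 k(1)])
      then have "\<epsilon> * L (k ^ q) \<le> \<epsilon> * L n" "0 \<le> \<epsilon> * \<epsilon> * L (k ^ q)" using e Lk by auto
      moreover have "0 \<le> (1 - \<epsilon>) * (\<epsilon> * (L n - L (k ^ q)))"
        using e \<open>L (k ^ q) \<le> L n\<close> by (intro mult_nonneg_nonneg) auto
      moreover have "0 \<le> \<epsilon> * L n" using e Ln by simp
      ultimately show ?thesis by (simp add: algebra_simps)
    qed
    also have "\<dots> \<le> F (k ^ q)" using Kk(1) by simp
    also have "\<dots> \<le> F n" by (rule mono(1)[OF n0 k(1)])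
    finally have "1 - 3 * \<epsilon> \<le> F n / L n" using Ln by (simp add: field_simps)
    with u show ?case by linarith
  qed
qed

lemma correlation_scale_pos: "0 < p \<Longrightarrow> 2 \<le> n \<Longrightarrow> 0 < correlation_scale p n"
  by (simp add: correlation_scale_def)

lemma correlation_scale_mono:
  assumes "2 \<le> m" "m \<le> n"
  shows "correlation_scale p m \<le> correlation_scale p n"
  unfolding correlation_scale_def
  by (intro real_sqrt_le_mono mult_mono) (use assms in auto)

lemma correlation_scale_power_ratio:
  assumes p: "0 < p" and q: "1 \<le> q"
  shows "(\<lambda>k. correlation_scale p (Suc k ^ q) / correlation_scale p (k ^ q)) \<longlonglongrightarrow> 1"
proof -
  have "(\<lambda>k::nat. (1 + k) / real k) \<longlonglongrightarrow> 1" "(\<lambda>k::nat. ln (1 + real k) / ln k) \<longlonglongrightarrow> 1"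
    by real_asymp+
  then have "(\<lambda>k::nat. sqrt (((1 + k) / real k) ^ q * (ln (1 + real k) / ln k))) \<longlonglongrightarrow> sqrt (1 ^ q * 1)"
    by (intro tendsto_intros)
  moreover have "\<forall>\<^sub>F k in sequentially. sqrt (((1 + k) / real k) ^ q * (ln (1 + real k) / ln k)) =
      correlation_scale p (Suc k ^ q) / correlation_scale p (k ^ q)"
    using eventually_ge_at_top[of 2]
  proof eventually_elim
    case (elim k)
    have "2 * real (Suc k ^ q) * (p * ln (Suc k ^ q)) / (2 * real (k ^ q) * (p * ln (k ^ q))) =
        ((1 + k) / real k) ^ q * (ln (1 + real k) / ln k)"
      using elim p q by (simp add: ln_realpow power_divide)
    then show ?case by (simp add: correlation_scale_def flip: real_sqrt_divide)
  qed
  ultimately show ?thesis by (simp add: tendsto_cong)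
qed

text \<open>
  From \<open>(n / p) ^ p \<le> n choose p \<le> n ^ p\<close>.
\<close>

lemma correlation_scale_binomial:
  assumes p: "0 < p"
  shows "(\<lambda>n. correlation_scale p n / sqrt (2 * n * ln (n choose p))) \<longlonglongrightarrow> 1"
proof -
  have "(\<lambda>n. ln (n choose p) / (p * ln n)) \<longlonglongrightarrow> 1"
  proof (rule tendsto_sandwich)
    show "(\<lambda>n. (ln (real n) - ln p) / ln n) \<longlonglongrightarrow> 1" by real_asymp
    show "(\<lambda>n::nat. 1 :: real) \<longlonglongrightarrow> 1" by simp
    show "\<forall>\<^sub>F n in sequentially. (ln (real n) - ln p) / ln n \<le> ln (n choose p) / (p * ln n)"
      using eventually_ge_at_top[of "max 2 p"]
    proof eventually_elim
      case (elim n)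
      have "(n / p) ^ p \<le> real (n choose p)" by (rule binomial_ge_n_over_k_pow_k) (use elim in auto)
      then have "ln ((n / p) ^ p) \<le> ln (n choose p)" using elim p by (intro ln_mono) auto
      moreover have "ln ((n / p) ^ p) = p * (ln (real n) - ln p)"
        using elim p by (simp add: ln_realpow ln_div)
      ultimately have "p * (ln (real n) - ln p) / (p * ln n) \<le> ln (n choose p) / (p * ln n)"
        using elim by (intro divide_right_mono) auto
      then show ?case using p by simp
    qed
    show "\<forall>\<^sub>F n in sequentially. ln (n choose p) / (p * ln n) \<le> 1"
      using eventually_ge_at_top[of "max 2 p"]
    proof eventually_elim
      case (elim n)
      have "real (n choose p) \<le> real (n ^ p)" using elim by (intro of_nat_mono binomial_le_pow) auto
      moreover have "0 < n choose p" using elim by simp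
      ultimately have "ln (n choose p) \<le> ln (real n ^ p)" by (intro ln_mono) auto
      then show ?case using elim p by (simp add: ln_realpow field_simps)
    qed
  qed
  then have "(\<lambda>n. sqrt (inverse (ln (n choose p) / (p * ln n)))) \<longlonglongrightarrow> sqrt (inverse 1)"
    by (intro tendsto_intros) auto
  moreover have "\<forall>\<^sub>F n in sequentially. sqrt (inverse (ln (n choose p) / (p * ln n))) =
      correlation_scale p n / sqrt (2 * n * ln (n choose p))"
    using eventually_ge_at_top[of 1]
    by eventually_elim (simp add: correlation_scale_def field_simps flip: real_sqrt_divide)
  ultimately show ?thesis by (simp add: tendsto_cong)
qed

theorem theorem1p1:
  fixes M :: "(nat \<Rightarrow> int) measure" and r :: nat
  assumes "prob_space M"
    and "sets M = sets sign_sequences"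
    and "\<And>n c. n \<ge> 1 \<Longrightarrow> c \<in> {1..n} \<rightarrow>\<^sub>E {-1, 1} \<Longrightarrow>
           \<P>(a in M. \<forall>i\<in>{1..n}. a i = c i) = 1 / 2 ^ n"
    and "r \<ge> 2"
  shows "AE a in M.
           (\<lambda>n. real_of_int (correlation_measure r n (initial_segment n a)) /
                sqrt (2 * real n * ln (real (n choose (r - 1))))) \<longlonglongrightarrow> 1"
proof -
  let ?L = "correlation_scale (r - 1)"
  let ?F = "\<lambda>a n. real_of_int (correlation_measure r n (initial_segment n a))"
  have p: "0 < r - 1" using assms(4) by simp
  have near: "AE a in M. \<forall>\<^sub>F n in sequentially. \<bar>?F a n / ?L n - 1\<bar> \<le> 3 * \<epsilon>"
    if e: "0 < \<epsilon>" "\<epsilon> \<le> 1" for \<epsilon> :: real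
  proof -
    obtain B where B: "\<And>n. r \<le> n \<Longrightarrow> 40 / (\<epsilon> / 2)\<^sup>2 \<le> n \<Longrightarrow>
      sign_prob n (\<lambda>a. (1 + 2 * (\<epsilon> / 2)) * ?L n \<le> of_int (correlation_measure r n a))
        \<le> B * real n powr (- (2 * (\<epsilon> / 2) * real (r - 1)))"
      by (rule correlation_upper_tail[OF assms(4), of "\<epsilon> / 2"]) (use e in auto)
    define c where "c = min (\<epsilon> * real (r - 1)) ((\<epsilon> / 4)\<^sup>2 * real (r - 1) / (real r)\<^sup>2)"
    have c: "0 < c" using e p assms(4) by (simp add: c_def)
    define q where "q = nat \<lceil>1 / c\<rceil> + 1"
    have "1 / c < q" unfolding q_def by linarith
    then have q: "1 \<le> q" "1 < q * c" using c by (auto simp: q_def field_simps)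
    have qc: "1 < q * c'" if "c \<le> c'" for c' :: real
      using q(2) mult_left_mono[OF that, of "real q"] by simp
    have "\<forall>\<^sub>F n in sequentially. sign_prob n (\<lambda>a. (1 + \<epsilon>) * ?L n \<le> of_int (correlation_measure r n a))
        \<le> B * real n powr (- (\<epsilon> * real (r - 1)))"
      using eventually_ge_at_top[of "max r (nat \<lceil>40 / (\<epsilon> / 2)\<^sup>2\<rceil>)"]
    proof eventually_elim
      case (elim n)
      then have "r \<le> n" "40 / (\<epsilon> / 2)\<^sup>2 \<le> n" by linarith+
      from B[OF this] show ?case by simp
    qed
    from AE_eventually_power_subsequence[OF assms(1-3) q(1) qc this]
    have up: "AE a in M. \<forall>\<^sub>F k in sequentially. \<not> (1 + \<epsilon>) * ?L (k ^ q) \<le> ?F a (k ^ q)"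
      by (simp add: c_def)
    have "\<forall>\<^sub>F n in sequentially. sign_prob n (\<lambda>a. of_int (correlation_measure r n a) \<le> (1 - 4 * (\<epsilon> / 4)) * ?L n)
        \<le> 1 * real n powr (- ((\<epsilon> / 4)\<^sup>2 * real (r - 1) / (real r)\<^sup>2))"
      using correlation_lower_tail[OF assms(4), of "\<epsilon> / 4"] e by simp
    from AE_eventually_power_subsequence[OF assms(1-3) q(1) qc this]
    have lo: "AE a in M. \<forall>\<^sub>F k in sequentially. \<not> ?F a (k ^ q) \<le> (1 - \<epsilon>) * ?L (k ^ q)"
      by (simp add: c_def)
    show ?thesis
      using up lo
    proof eventually_elim
      case (elim a)
      show ?case
      proof (rule ratio_bound_from_powers[OF e q(1)])
        show "?F a m \<le> ?F a n" if "r \<le> m" "m \<le> n" for m n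
          using correlation_mono[of r m n "initial_segment m a" "initial_segment n a"] that assms(4)
          by (simp add: initial_segment_def)
        show "?L m \<le> ?L n" if "r \<le> m" "m \<le> n" for m n
          using correlation_scale_mono that assms(4) by simp
        show "0 < ?L n" if "r \<le> n" for n using correlation_scale_pos[OF p] that assms(4) by simp
        show "(\<lambda>k. ?L (Suc k ^ q) / ?L (k ^ q)) \<longlonglongrightarrow> 1" by (rule correlation_scale_power_ratio[OF p q(1)])
        show "\<forall>\<^sub>F k in sequentially. ?F a (k ^ q) \<le> (1 + \<epsilon>) * ?L (k ^ q)"
          using elim(1) by (rule eventually_mono) simp
        show "\<forall>\<^sub>F k in sequentially. (1 - \<epsilon>) * ?L (k ^ q) \<le> ?F a (k ^ q)"
          using elim(2) by (rule eventually_mono) simp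
      qed
    qed
  qed
  have "AE a in M. \<forall>j. \<forall>\<^sub>F n in sequentially. \<bar>?F a n / ?L n - 1\<bar> \<le> 3 * (1 / real (Suc j))"
    unfolding AE_all_countable by (intro allI near) auto
  then show ?thesis
  proof eventually_elim
    case (elim a)
    have "(\<lambda>n. ?F a n / ?L n) \<longlonglongrightarrow> 1"
    proof (rule tendstoI)
      fix e :: real assume "0 < e"
      then obtain j where j: "1 / real (Suc j) < e / 3"
        using nat_approx_posE[of "e / 3"] by auto
      show "\<forall>\<^sub>F n in sequentially. dist (?F a n / ?L n) 1 < e"
        using spec[OF elim, of j] by (rule eventually_mono) (use j in \<open>auto simp: dist_real_def\<close>)
    qed
    from tendsto_mult[OF this correlation_scale_binomial[OF p]]
    have "(\<lambda>n. ?F a n / ?L n * (?L n / sqrt (2 * real n * ln (real (n choose (r - 1)))))) \<longlonglongrightarrow> 1" by simp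
    moreover have "\<forall>\<^sub>F n in sequentially. ?F a n / ?L n * (?L n / sqrt (2 * real n * ln (real (n choose (r - 1))))) =
        ?F a n / sqrt (2 * real n * ln (real (n choose (r - 1))))"
      using eventually_ge_at_top[of 2]
    proof eventually_elim
      case (elim n)
      then show ?case using correlation_scale_pos[OF p, of n] by simp
    qed
    ultimately show ?case by (rule Lim_transform_eventually)
  qed
qed

end
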